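(* Let $G$ be the group generated under composition by the (rational) maps $$R(x_3,x_4)=(-x_3,-x_4),\qquad S(x_3,x_4)=\left(\frac{3+x_3}{1-x_3},\ \frac{-2x_4+1+x_3}{1-x_3}\right).$$ Then $G$ is isomorphic to the symmetric group $S_3$, and the elimination ideal $\overline F=F\cap\mathbb{Q}[x_3,x_4,m]$ is invariant under $G$. Consequently, solutions to the system $$\begin{aligned} \omega(-1-c)+\tfrac12+\tfrac1{x_3+1}+\tfrac{m}{x_4+1}&=0,\\ \omega(1-c)-\tfrac12+\tfrac1{x_3-1}+\tfrac{m}{x_4-1}&=0,\\ \omega(x_3-c)-\tfrac1{x_3+1}-\tfrac1{x_3-1}+\tfrac{m}{x_4-x_3}&=0,\\ \omega(x_4-c)-\tfrac1{x_4+1}-\tfrac1{x_4-1}-\tfrac1{x_4-x_3}&=0 \end{aligned}$$ come in groups of six: for each fixed real $m$, if $(x_3,x_4)$ are the position coordinates of a real solution, then the six points $g(x_3,x_4)$, $g\in G$, are distinct and each of them is again the pair of position coordinates of a solution for the same $m$.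
   Context: The displayed system, in unknowns $\omega,c,x_3,x_4$ with parameter $m\in\mathbb{R}$, describes collinear relative equilibria of four vortices on the $x$-axis with circulations $1,1,1,m$ and positions $x_1=-1,\ x_2=1,\ x_3,\ x_4$ (angular velocity $\omega$, center of vorticity $c$); solutions have pairwise distinct positions. Let $f_1,f_2,f_3,f_4$ be the numerators of the left-hand sides of the four equations (over the common denominators), let $f_5=u(x_4-1)-1$ and $f_6=v(x_4+1)-1$, and let $F$ be the ideal generated by $f_1,\dots,f_6$ in $\mathbb{Q}[\omega,c,u,v,x_4,x_3,m]$. Invariance of $\overline F$ under a map $g\in G$ is understood after clearing denominators: for every $p(x_3,x_4,m)\in\overline F$, the numerator of the rational function $p(g(x_3,x_4),m)$ belongs to $\overline F$. *)

theory Defs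
  imports
    Complex_Main
    "HOL-Library.Poly_Mapping"
    "HOL-Computational_Algebra.Fraction_Field"
    "HOL-Algebra.Generated_Groups"
    "HOL-Algebra.Sym_Groups"
begin

section \<open>The ring \<open>\<rat>[\<omega>, c, u, v, x\<^sub>4, x\<^sub>3, m]\<close> and its fraction field\<close>

datatype pvar = V_omega | V_c | V_u | V_v | V_x4 | V_x3 | V_m

text \<open>
  The order on the variables carries no mathematical content here: the library obtains the
  integral domain structure on polynomials, which \<^type>\<open>fract\<close> requires, from a linear order
  on the monomials.
\<close>

primrec pvar_index :: "pvar \<Rightarrow> nat" where
  "pvar_index V_omega = 0"
| "pvar_index V_c = 1"
| "pvar_index V_u = 2"
| "pvar_index V_v = 3"
| "pvar_index V_x4 = 4"
| "pvar_index V_x3 = 5"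
| "pvar_index V_m = 6"

lemma pvar_index_inject: "pvar_index a = pvar_index b \<longleftrightarrow> a = b"
  by (cases a; cases b; simp)

instantiation pvar :: linorder
begin

definition less_eq_pvar :: "pvar \<Rightarrow> pvar \<Rightarrow> bool" where
  "less_eq_pvar a b \<longleftrightarrow> pvar_index a \<le> pvar_index b"

definition less_pvar :: "pvar \<Rightarrow> pvar \<Rightarrow> bool" where
  "less_pvar a b \<longleftrightarrow> pvar_index a < pvar_index b"

instance
  by standard (auto simp: less_eq_pvar_def less_pvar_def pvar_index_inject)

end

type_synonym mpol = "(pvar \<Rightarrow>\<^sub>0 nat) \<Rightarrow>\<^sub>0 rat"
type_synonym ratfun = "mpol fract"

lemma of_nat_fract: "(of_nat n :: 'a::idom fract) = Fract (of_nat n) 1"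
  by (induction n) (simp_all add: Zero_fract_def One_fract_def add_fract)

instance fract :: ("{idom,ring_char_0}") field_char_0
  by standard (auto simp: inj_on_def of_nat_fract eq_fract)

definition Var :: "pvar \<Rightarrow> mpol" where
  "Var v = Poly_Mapping.single (Poly_Mapping.single v 1) 1"

definition rvar :: "pvar \<Rightarrow> ratfun" where
  "rvar v = Fract (Var v) 1"

definition peval :: "(pvar \<Rightarrow> 'a::field_char_0) \<Rightarrow> mpol \<Rightarrow> 'a" where
  "peval \<sigma> p = (\<Sum>k\<in>Poly_Mapping.keys p. of_rat (Poly_Mapping.lookup p k) *
     (\<Prod>v\<in>Poly_Mapping.keys k. \<sigma> v ^ Poly_Mapping.lookup k v))"

definition polys_in :: "pvar set \<Rightarrow> mpol set" where
  "polys_in W = {p. \<forall>k\<in>Poly_Mapping.keys p. Poly_Mapping.keys k \<subseteq> W}"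

definition ratfuns_in :: "pvar set \<Rightarrow> ratfun set" where
  "ratfuns_in W = {Fract a b | a b. a \<in> polys_in W \<and> b \<in> polys_in W \<and> b \<noteq> 0}"

text \<open>
  Substituting elements of a field for the variables of a rational function. The field is \<open>\<real>\<close>
  when the rational function is evaluated at a point, and the field of rational functions itself
  when rational maps are composed. The value is meaningful if some representation has a
  denominator that does not vanish under the substitution; it then does not depend on the
  representation.
\<close>

definition rdefined :: "(pvar \<Rightarrow> 'a::field_char_0) \<Rightarrow> ratfun \<Rightarrow> bool" where
  "rdefined \<sigma> f \<longleftrightarrow> (\<exists>a b. f = Fract a b \<and> peval \<sigma> b \<noteq> 0)"

definition reval :: "(pvar \<Rightarrow> 'a::field_char_0) \<Rightarrow> ratfun \<Rightarrow> 'a" where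
  "reval \<sigma> f = (THE y. \<exists>a b. f = Fract a b \<and> peval \<sigma> b \<noteq> 0 \<and> y = peval \<sigma> a / peval \<sigma> b)"


section \<open>Rational maps of the \<open>(x\<^sub>3, x\<^sub>4)\<close>-plane\<close>

type_synonym ratmap = "ratfun \<times> ratfun"

definition map_subst :: "ratmap \<Rightarrow> pvar \<Rightarrow> ratfun" where
  "map_subst g v = (if v = V_x3 then fst g else if v = V_x4 then snd g else rvar v)"

definition ratmap_comp :: "ratmap \<Rightarrow> ratmap \<Rightarrow> ratmap" where
  "ratmap_comp g h = (reval (map_subst h) (fst g), reval (map_subst h) (snd g))"

text \<open>
  Composition of rational maps is defined for dominant ones, those whose two coordinates are
  algebraically independent over \<open>\<rat>\<close>. The invertible elements of the monoid of dominant rational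
  maps form the group of birational maps of the plane, in which \<open>R\<close> and \<open>S\<close> generate a subgroup.
\<close>

definition dominant :: "ratmap \<Rightarrow> bool" where
  "dominant g \<longleftrightarrow> fst g \<in> ratfuns_in {V_x3, V_x4} \<and> snd g \<in> ratfuns_in {V_x3, V_x4} \<and>
     (\<forall>p\<in>polys_in {V_x3, V_x4}. p \<noteq> 0 \<longrightarrow> peval (map_subst g) p \<noteq> 0)"

definition ratmap_monoid :: "ratmap monoid" where
  "ratmap_monoid = \<lparr>carrier = {g. dominant g}, mult = ratmap_comp, one = (rvar V_x3, rvar V_x4)\<rparr>"

definition birational_group :: "ratmap monoid" where
  "birational_group = units_of ratmap_monoid"

definition map_R :: ratmap where
  "map_R = (- rvar V_x3, - rvar V_x4)"

definition map_S :: ratmap where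
  "map_S = ((3 + rvar V_x3) / (1 - rvar V_x3), (- 2 * rvar V_x4 + 1 + rvar V_x3) / (1 - rvar V_x3))"

definition group_RS :: "ratmap monoid" where
  "group_RS = birational_group\<lparr>carrier := generate birational_group {map_R, map_S}\<rparr>"

text \<open>The variables other than \<open>x\<^sub>3, x\<^sub>4\<close> do not occur in the maps, so the value 0 is immaterial.\<close>

definition point_subst :: "real \<times> real \<Rightarrow> pvar \<Rightarrow> real" where
  "point_subst P v = (if v = V_x3 then fst P else if v = V_x4 then snd P else 0)"

definition map_defined_at :: "ratmap \<Rightarrow> real \<times> real \<Rightarrow> bool" where
  "map_defined_at g P \<longleftrightarrow> rdefined (point_subst P) (fst g) \<and> rdefined (point_subst P) (snd g)"

definition map_at :: "ratmap \<Rightarrow> real \<times> real \<Rightarrow> real \<times> real" where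
  "map_at g P = (reval (point_subst P) (fst g), reval (point_subst P) (snd g))"


section \<open>The ideal and its elimination ideal\<close>

text \<open>
  The numerators of the four equations are taken over the common denominators
  \<open>2 (x\<^sub>3 + 1) (x\<^sub>4 + 1)\<close>, \<open>2 (x\<^sub>3 - 1) (x\<^sub>4 - 1)\<close>, \<open>(x\<^sub>3 + 1) (x\<^sub>3 - 1) (x\<^sub>4 - x\<^sub>3)\<close> and
  \<open>(x\<^sub>4 + 1) (x\<^sub>4 - 1) (x\<^sub>4 - x\<^sub>3)\<close>.
\<close>

definition f1 :: mpol where
  "f1 = 2 * Var V_omega * (- 1 - Var V_c) * (Var V_x3 + 1) * (Var V_x4 + 1)
      + (Var V_x3 + 1) * (Var V_x4 + 1) + 2 * (Var V_x4 + 1) + 2 * Var V_m * (Var V_x3 + 1)"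

definition f2 :: mpol where
  "f2 = 2 * Var V_omega * (1 - Var V_c) * (Var V_x3 - 1) * (Var V_x4 - 1)
      - (Var V_x3 - 1) * (Var V_x4 - 1) + 2 * (Var V_x4 - 1) + 2 * Var V_m * (Var V_x3 - 1)"

definition f3 :: mpol where
  "f3 = Var V_omega * (Var V_x3 - Var V_c) * (Var V_x3 + 1) * (Var V_x3 - 1) * (Var V_x4 - Var V_x3)
      - (Var V_x3 - 1) * (Var V_x4 - Var V_x3) - (Var V_x3 + 1) * (Var V_x4 - Var V_x3)
      + Var V_m * (Var V_x3 + 1) * (Var V_x3 - 1)"

definition f4 :: mpol where
  "f4 = Var V_omega * (Var V_x4 - Var V_c) * (Var V_x4 + 1) * (Var V_x4 - 1) * (Var V_x4 - Var V_x3)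
      - (Var V_x4 - 1) * (Var V_x4 - Var V_x3) - (Var V_x4 + 1) * (Var V_x4 - Var V_x3)
      - (Var V_x4 + 1) * (Var V_x4 - 1)"

definition f5 :: mpol where
  "f5 = Var V_u * (Var V_x4 - 1) - 1"

definition f6 :: mpol where
  "f6 = Var V_v * (Var V_x4 + 1) - 1"

text \<open>The ideal generated by a set is its span in the ring regarded as a module over itself.\<close>

definition vortex_ideal :: "mpol set" where
  "vortex_ideal = module.span (*) {f1, f2, f3, f4, f5, f6}"

definition elim_ideal :: "mpol set" where
  "elim_ideal = vortex_ideal \<inter> polys_in {V_x3, V_x4, V_m}"

text \<open>
  Every way of writing \<open>p(g(x\<^sub>3, x\<^sub>4), m)\<close> as a quotient of polynomials in \<open>x\<^sub>3, x\<^sub>4, m\<close> is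
  considered, in particular the one in lowest terms.
\<close>

definition invariant_under :: "mpol set \<Rightarrow> ratmap \<Rightarrow> bool" where
  "invariant_under I g \<longleftrightarrow>
     (\<forall>p\<in>I. \<forall>N\<in>polys_in {V_x3, V_x4, V_m}. \<forall>D\<in>polys_in {V_x3, V_x4, V_m}.
        D \<noteq> 0 \<longrightarrow> peval (map_subst g) p = Fract N D \<longrightarrow> N \<in> I)"


section \<open>Collinear relative equilibria\<close>

definition is_solution :: "real \<Rightarrow> real \<Rightarrow> real \<Rightarrow> real \<times> real \<Rightarrow> bool" where
  "is_solution m \<omega> c P \<longleftrightarrow> (case P of (x3, x4) \<Rightarrow>
     distinct [-1, 1, x3, x4] \<and>
     \<omega> * (- 1 - c) + 1 / 2 + 1 / (x3 + 1) + m / (x4 + 1) = 0 \<and>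
     \<omega> * (1 - c) - 1 / 2 + 1 / (x3 - 1) + m / (x4 - 1) = 0 \<and>
     \<omega> * (x3 - c) - 1 / (x3 + 1) - 1 / (x3 - 1) + m / (x4 - x3) = 0 \<and>
     \<omega> * (x4 - c) - 1 / (x4 + 1) - 1 / (x4 - 1) - 1 / (x4 - x3) = 0)"

definition is_position :: "real \<Rightarrow> real \<times> real \<Rightarrow> bool" where
  "is_position m P \<longleftrightarrow> (\<exists>\<omega> c. is_solution m \<omega> c P)"

end

(*
  The equations, written as omega (z_i - c) + sum_{j <> i} m_j / (z_j - z_i) = 0, are permuted when
  the three vortices of circulation 1 are relabelled, and an affine change of coordinates only
  rescales them, with omega and c changing accordingly. Relabelling the first three vortices and
  then restoring x_1 = -1, x_2 = 1 affinely is therefore an action of S_3 on pairs (x_3, x_4);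
  R and S are the relabellings by a transposition and a 3-cycle.

  For the ideal, every difference of positions is a unit modulo F, although only x_4 - 1 and x_4 + 1
  are inverted by u and v. So the relabelling, extended to omega, c, u, v, maps F into its extension
  to the ring of fractions whose denominators are units modulo F, and that extension contracts back
  to F. This shows that numerators stay in F whatever denominator is chosen.

  For distinctness, if two relabellings of a real configuration agree, an affine map with linear part
  A fixes x_4 and permutes the other three points, whence A^3 = 1 and A = 1.
*)
theory Submission
  imports Defs
begin

section \<open>Evaluation of polynomials and rational functions\<close>

lemma UNIV_pvar: "UNIV = {V_omega, V_c, V_u, V_v, V_x4, V_x3, V_m}"
  using pvar.exhaust by blast

instance pvar :: finite
  by standard (simp add: UNIV_pvar)

text \<open>The product runs over all variables instead of the support, so that adding exponents
  needs no case distinction; absent variables contribute a factor 1.\<close>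

definition mono_eval :: "(pvar \<Rightarrow> 'a::field_char_0) \<Rightarrow> (pvar \<Rightarrow>\<^sub>0 nat) \<Rightarrow> 'a" where
  "mono_eval \<sigma> k = (\<Prod>v\<in>UNIV. \<sigma> v ^ Poly_Mapping.lookup k v)"

lemma mono_eval_0 [simp]: "mono_eval \<sigma> 0 = 1"
  by (simp add: mono_eval_def)

lemma mono_eval_add: "mono_eval \<sigma> (k + l) = mono_eval \<sigma> k * mono_eval \<sigma> l"
  by (simp add: mono_eval_def lookup_add power_add prod.distrib)

lemma mono_eval_single: "mono_eval \<sigma> (Poly_Mapping.single v 1) = \<sigma> v"
proof -
  have "mono_eval \<sigma> (Poly_Mapping.single v 1) = (\<Prod>w\<in>UNIV. if w = v then \<sigma> v else 1)"
    unfolding mono_eval_def by (rule prod.cong) (auto simp: lookup_single when_def)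
  then show ?thesis by simp
qed

text \<open>Monomials outside the support have coefficient 0. A common index set for several
  polynomials turns additivity into a statement about finite sums.\<close>

lemma peval_superset:
  assumes "finite A" "Poly_Mapping.keys p \<subseteq> A"
  shows "peval \<sigma> p = (\<Sum>k\<in>A. of_rat (Poly_Mapping.lookup p k) * mono_eval \<sigma> k)"
proof -
  have mono: "(\<Prod>v\<in>Poly_Mapping.keys k. \<sigma> v ^ Poly_Mapping.lookup k v) = mono_eval \<sigma> k" for k
    unfolding mono_eval_def by (rule prod.mono_neutral_left) (auto simp: in_keys_iff)
  show ?thesis
    unfolding peval_def mono using assms
    by (intro sum.mono_neutral_left) (auto simp: in_keys_iff)
qed

lemma peval_0 [simp]: "peval \<sigma> 0 = 0"
  by (simp add: peval_def)

lemma peval_add: "peval \<sigma> (p + q) = peval \<sigma> p + peval \<sigma> q"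
proof -
  let ?A = "Poly_Mapping.keys p \<union> Poly_Mapping.keys q"
  have "peval \<sigma> r = (\<Sum>k\<in>?A. of_rat (Poly_Mapping.lookup r k) * mono_eval \<sigma> k)"
    if "r \<in> {p, q, p + q}" for r
    using that keys_add[of p q] by (intro peval_superset) auto
  then show ?thesis
    by (simp add: lookup_add of_rat_add distrib_right sum.distrib)
qed

lemma peval_single: "peval \<sigma> (Poly_Mapping.single k a) = of_rat a * mono_eval \<sigma> k"
  by (subst peval_superset[of "{k}"]) auto

text \<open>Updating at a fresh key amounts to adding a single term. The rule serves for polynomials
  and also for exponents of monomials, which are finitely supported maps too.\<close>

lemma poly_mapping_add_induct [case_names zero single add]:
  assumes "P 0" "\<And>k a. P (Poly_Mapping.single k a)" "\<And>p q. P p \<Longrightarrow> P q \<Longrightarrow> P (p + q)"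
  shows "P (p :: 'a \<Rightarrow>\<^sub>0 'b::comm_monoid_add)"
proof (induction p rule: update_induct)
  case (update f a b)
  have "Poly_Mapping.update a b f = f + Poly_Mapping.single a b"
    using update.hyps
    by (intro poly_mapping_eqI) (auto simp: lookup_update lookup_add lookup_single when_def in_keys_iff)
  with update.IH assms show ?case by simp
qed (rule assms)

text \<open>Both sides are additive in each factor, so two inductions reduce the claim to a product
  of two terms, where exponents add.\<close>

lemma peval_mult: "peval \<sigma> (p * q) = peval \<sigma> p * peval \<sigma> q"
proof (induction p rule: poly_mapping_add_induct)
  case (single k a)
  show ?case
    by (induction q rule: poly_mapping_add_induct)
      (simp_all add: mult_single peval_single peval_add mono_eval_add of_rat_mult distrib_left)
qed (simp_all add: peval_add distrib_right)

lemma peval_1 [simp]: "peval \<sigma> 1 = 1"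
  using peval_single[of \<sigma> 0 1] by simp

lemma peval_numeral [simp]: "peval \<sigma> (numeral n) = numeral n"
  using peval_single[of \<sigma> 0 "numeral n"] by simp

lemma peval_Var [simp]: "peval \<sigma> (Var v) = \<sigma> v"
  by (simp add: Var_def peval_single mono_eval_single del: One_nat_def)

lemma peval_minus: "peval \<sigma> (- p) = - peval \<sigma> p"
  using peval_add[of \<sigma> p "- p"] by (simp add: eq_neg_iff_add_eq_0 add.commute)

lemma peval_diff: "peval \<sigma> (p - q) = peval \<sigma> p - peval \<sigma> q"
  using peval_add[of \<sigma> p "- q"] by (simp add: peval_minus)

lemmas peval_hom = peval_add peval_diff peval_minus peval_mult

lemma peval_cong:
  assumes "p \<in> polys_in W" "\<And>v. v \<in> W \<Longrightarrow> \<sigma> v = \<tau> v"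
  shows "peval \<sigma> p = peval \<tau> p"
  unfolding peval_def
proof (intro sum.cong arg_cong2[where f = "(*)"] prod.cong refl)
  fix k v assume "k \<in> Poly_Mapping.keys p" "v \<in> Poly_Mapping.keys k"
  with assms have "\<sigma> v = \<tau> v" unfolding polys_in_def by blast
  then show "\<sigma> v ^ Poly_Mapping.lookup k v = \<tau> v ^ Poly_Mapping.lookup k v" by simp
qed

section \<open>Values of rational functions\<close>

lemma rdefined_Fract: "peval \<sigma> b \<noteq> 0 \<Longrightarrow> rdefined \<sigma> (Fract a b)"
  unfolding rdefined_def by blast

text \<open>Cross-multiplying two representations gives a polynomial identity, and evaluating it
  shows that their values agree. This is the uniqueness behind \<open>THE\<close>.\<close>

lemma reval_Fract:
  assumes "peval \<sigma> b \<noteq> 0"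
  shows "reval \<sigma> (Fract a b) = peval \<sigma> a / peval \<sigma> b"
  unfolding reval_def
proof (rule the_equality)
  fix y assume "\<exists>a' b'. Fract a b = Fract a' b' \<and> peval \<sigma> b' \<noteq> 0 \<and> y = peval \<sigma> a' / peval \<sigma> b'"
  then obtain a' b' where eq: "Fract a b = Fract a' b'" and b': "peval \<sigma> b' \<noteq> 0"
    and y: "y = peval \<sigma> a' / peval \<sigma> b'" by blast
  have "b \<noteq> 0" "b' \<noteq> 0" using assms b' by auto
  then have "peval \<sigma> (a * b') = peval \<sigma> (a' * b)"
    using eq by (simp add: eq_fract)
  then show "y = peval \<sigma> a / peval \<sigma> b"
    using assms b' y by (simp add: peval_mult frac_eq_eq)
qed (use assms in blast)

lemma rdefinedE:
  assumes "rdefined \<sigma> f"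
  obtains a b where "f = Fract a b" "peval \<sigma> b \<noteq> 0" "b \<noteq> 0" "reval \<sigma> f = peval \<sigma> a / peval \<sigma> b"
  using assms reval_Fract peval_0 unfolding rdefined_def by metis

lemma
  shows rdefined_poly [simp]: "rdefined \<sigma> (Fract p 1)"
    and reval_poly [simp]: "reval \<sigma> (Fract p 1) = peval \<sigma> p"
  by (simp_all add: rdefined_Fract reval_Fract)

lemma
  shows rdefined_rvar [simp]: "rdefined \<sigma> (rvar v)"
    and reval_rvar [simp]: "reval \<sigma> (rvar v) = \<sigma> v"
  by (simp_all add: rvar_def)

lemma
  shows rdefined_0 [simp]: "rdefined \<sigma> 0" and reval_0 [simp]: "reval \<sigma> 0 = 0"
    and rdefined_1 [simp]: "rdefined \<sigma> 1" and reval_1 [simp]: "reval \<sigma> 1 = 1"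
  using rdefined_poly[of \<sigma> 0] reval_poly[of \<sigma> 0] rdefined_poly[of \<sigma> 1] reval_poly[of \<sigma> 1]
  by (simp_all add: fract_collapse)

lemma
  assumes "rdefined \<sigma> f" "rdefined \<sigma> g"
  shows rdefined_add: "rdefined \<sigma> (f + g)" and reval_add: "reval \<sigma> (f + g) = reval \<sigma> f + reval \<sigma> g"
    and rdefined_mult: "rdefined \<sigma> (f * g)" and reval_mult: "reval \<sigma> (f * g) = reval \<sigma> f * reval \<sigma> g"
proof -
  obtain a b where f: "f = Fract a b" "peval \<sigma> b \<noteq> 0" "b \<noteq> 0" "reval \<sigma> f = peval \<sigma> a / peval \<sigma> b"
    using assms(1) by (rule rdefinedE)
  obtain c d where g: "g = Fract c d" "peval \<sigma> d \<noteq> 0" "d \<noteq> 0" "reval \<sigma> g = peval \<sigma> c / peval \<sigma> d"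
    using assms(2) by (rule rdefinedE)
  have bd: "peval \<sigma> (b * d) \<noteq> 0" using f g by (simp add: peval_mult)
  have sum: "f + g = Fract (a * d + c * b) (b * d)" using f g by simp
  have prod: "f * g = Fract (a * c) (b * d)" using f g by simp
  show "rdefined \<sigma> (f + g)" "rdefined \<sigma> (f * g)"
    unfolding sum prod using bd by (simp_all add: rdefined_Fract)
  show "reval \<sigma> (f + g) = reval \<sigma> f + reval \<sigma> g" "reval \<sigma> (f * g) = reval \<sigma> f * reval \<sigma> g"
    unfolding f(4) g(4) unfolding sum prod reval_Fract[OF bd] using f(2) g(2)
    by (simp_all add: peval_hom add_frac_eq)
qed

lemma
  assumes "rdefined \<sigma> f"
  shows rdefined_minus: "rdefined \<sigma> (- f)" and reval_minus: "reval \<sigma> (- f) = - reval \<sigma> f"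
proof -
  have m1: "-1 = Fract (-1) 1" by (simp add: One_fract_def)
  have "rdefined \<sigma> (-1)" "reval \<sigma> (-1) = -1" unfolding m1 by (simp_all add: peval_minus)
  with assms rdefined_mult[of \<sigma> "-1" f] reval_mult[of \<sigma> "-1" f]
  show "rdefined \<sigma> (- f)" "reval \<sigma> (- f) = - reval \<sigma> f" by simp_all
qed

lemma
  assumes "rdefined \<sigma> f" "reval \<sigma> f \<noteq> 0"
  shows rdefined_inverse: "rdefined \<sigma> (inverse f)"
    and reval_inverse: "reval \<sigma> (inverse f) = inverse (reval \<sigma> f)"
proof -
  obtain a b where f: "f = Fract a b" "peval \<sigma> b \<noteq> 0" "b \<noteq> 0" "reval \<sigma> f = peval \<sigma> a / peval \<sigma> b"
    using assms(1) by (rule rdefinedE)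
  with assms(2) have "peval \<sigma> a \<noteq> 0" by simp
  with f show "rdefined \<sigma> (inverse f)" "reval \<sigma> (inverse f) = inverse (reval \<sigma> f)"
    by (simp_all add: rdefined_Fract reval_Fract)
qed

lemma
  assumes "rdefined \<sigma> f" "rdefined \<sigma> g"
  shows rdefined_diff: "rdefined \<sigma> (f - g)" and reval_diff: "reval \<sigma> (f - g) = reval \<sigma> f - reval \<sigma> g"
  using rdefined_add[of \<sigma> f "- g"] reval_add[of \<sigma> f "- g"] assms rdefined_minus[of \<sigma> g] reval_minus[of \<sigma> g]
  by simp_all

lemma
  assumes "rdefined \<sigma> f" "rdefined \<sigma> g" "reval \<sigma> g \<noteq> 0"
  shows rdefined_divide: "rdefined \<sigma> (f / g)" and reval_divide: "reval \<sigma> (f / g) = reval \<sigma> f / reval \<sigma> g"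
  using rdefined_mult[OF assms(1) rdefined_inverse[OF assms(2,3)]]
    reval_mult[OF assms(1) rdefined_inverse[OF assms(2,3)]] reval_inverse[OF assms(2,3)]
  by (simp_all add: divide_inverse)

lemma
  assumes "rdefined \<sigma> f"
  shows rdefined_power: "rdefined \<sigma> (f ^ n)" and reval_power: "reval \<sigma> (f ^ n) = reval \<sigma> f ^ n"
proof -
  have "rdefined \<sigma> (f ^ n) \<and> reval \<sigma> (f ^ n) = reval \<sigma> f ^ n"
    using assms by (induction n) (simp_all add: rdefined_mult reval_mult)
  then show "rdefined \<sigma> (f ^ n)" "reval \<sigma> (f ^ n) = reval \<sigma> f ^ n" by simp_all
qed

text \<open>Links the coefficients, which \<open>peval\<close> embeds by \<open>of_rat\<close>, to
  constant polynomials viewed as fractions; the rational case follows from the integers by clearing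
  the denominator.\<close>

lemma Fract_const: "Fract (Poly_Mapping.single 0 a) 1 = (of_rat a :: ratfun)"
proof -
  have int: "Fract (of_int n) 1 = (of_int n :: ratfun)" for n
    by (cases n rule: int_cases2) (simp_all add: Fract_of_nat_eq flip: minus_fract)
  obtain n d where a: "a = of_int n / of_int d" "d \<noteq> 0"
    by (cases a) (auto simp: Fract_of_int_quotient)
  have "Poly_Mapping.single 0 a * of_int d = (of_int n :: mpol)"
    using a by (simp add: mult_single flip: single_of_int)
  then have "Fract (Poly_Mapping.single 0 a) 1 = Fract (of_int n :: mpol) (of_int d)"
    using a by (simp add: eq_fract)
  also have "\<dots> = Fract (of_int n) 1 / Fract (of_int d) 1" by simp
  finally show ?thesis using a by (simp add: int of_rat_divide)
qed

text \<open>Substituting every variable for itself is the embedding of polynomials into their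
  fraction field: both are additive and multiplicative and agree on constants and variables.\<close>

lemma peval_rvar: "peval rvar p = Fract p 1"
proof (induction p rule: poly_mapping_add_induct)
  case (single k a)
  have add: "Fract (Poly_Mapping.single (k + l) 1) 1 =
      Fract (Poly_Mapping.single k 1) 1 * (Fract (Poly_Mapping.single l 1) 1 :: ratfun)" for k l
    by (simp add: mult_single)
  have "Fract (Poly_Mapping.single k 1) 1 = mono_eval rvar k"
  proof (induction k rule: poly_mapping_add_induct)
    case (single v n)
    show ?case
    proof (induction n)
      case (Suc n)
      have "Poly_Mapping.single v (Suc n) = Poly_Mapping.single v 1 + Poly_Mapping.single v n"
        by (simp flip: single_add)
      moreover have "Fract (Poly_Mapping.single (Poly_Mapping.single v 1) 1) 1 = rvar v"
        by (simp add: rvar_def Var_def)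
      ultimately show ?case
        using Suc by (simp add: add mono_eval_add mono_eval_single del: One_nat_def mult_fract)
    qed (simp add: One_fract_def)
  qed (simp_all add: add mono_eval_add One_fract_def del: mult_fract)
  moreover have "Fract (Poly_Mapping.single k a) 1 =
      Fract (Poly_Mapping.single 0 a) 1 * (Fract (Poly_Mapping.single k 1) 1 :: ratfun)"
    by (simp add: mult_single)
  ultimately show ?case
    by (simp add: peval_single Fract_const)
qed (simp_all add: peval_add Zero_fract_def)

text \<open>Evaluation commutes with sums, products and rational constants, hence with substitution.
  The laws of composition of rational maps rest on this.\<close>

lemma
  assumes "\<And>v. rdefined \<sigma> (\<tau> v)"
  shows rdefined_peval: "rdefined \<sigma> (peval \<tau> p)"
    and reval_peval: "reval \<sigma> (peval \<tau> p) = peval (\<lambda>v. reval \<sigma> (\<tau> v)) p"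
proof -
  have const: "rdefined \<sigma> (of_rat a)" "reval \<sigma> (of_rat a) = of_rat a" for a
    using peval_single[of \<sigma> 0 a] by (simp_all flip: Fract_const)
  have "rdefined \<sigma> (\<Prod>v\<in>V. \<tau> v ^ n v) \<and> reval \<sigma> (\<Prod>v\<in>V. \<tau> v ^ n v) = (\<Prod>v\<in>V. reval \<sigma> (\<tau> v) ^ n v)"
    for V n
    by (induction V rule: infinite_finite_induct)
      (simp_all add: assms rdefined_mult reval_mult rdefined_power reval_power)
  then have mono: "rdefined \<sigma> (mono_eval \<tau> k) \<and> reval \<sigma> (mono_eval \<tau> k) = mono_eval (\<lambda>v. reval \<sigma> (\<tau> v)) k"
    for k
    unfolding mono_eval_def .
  have "rdefined \<sigma> (peval \<tau> p) \<and> reval \<sigma> (peval \<tau> p) = peval (\<lambda>v. reval \<sigma> (\<tau> v)) p"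
    by (induction p rule: poly_mapping_add_induct)
      (simp_all add: peval_add peval_single rdefined_add reval_add rdefined_mult reval_mult const mono)
  then show "rdefined \<sigma> (peval \<tau> p)" "reval \<sigma> (peval \<tau> p) = peval (\<lambda>v. reval \<sigma> (\<tau> v)) p" by simp_all
qed

section \<open>The monoid of dominant rational maps\<close>

lemma polys_in_mult: "p \<in> polys_in W \<Longrightarrow> q \<in> polys_in W \<Longrightarrow> p * q \<in> polys_in W"
proof -
  assume pq: "p \<in> polys_in W" "q \<in> polys_in W"
  show "p * q \<in> polys_in W"
    unfolding polys_in_def
  proof (intro CollectI ballI)
    fix k assume "k \<in> Poly_Mapping.keys (p * q)"
    then obtain a b where "k = a + b" "a \<in> Poly_Mapping.keys p" "b \<in> Poly_Mapping.keys q"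
      using keys_mult by blast
    then show "Poly_Mapping.keys k \<subseteq> W"
      using pq keys_add[of a b] unfolding polys_in_def by blast
  qed
qed

lemma polys_in_add: "p \<in> polys_in W \<Longrightarrow> q \<in> polys_in W \<Longrightarrow> p + q \<in> polys_in W"
  using keys_add[of p q] unfolding polys_in_def by blast

lemma polys_in_const: "Poly_Mapping.single 0 a \<in> polys_in W"
  by (simp add: polys_in_def)

lemma polys_in_1: "1 \<in> polys_in W"
  by (simp add: polys_in_def)

lemma polys_in_0: "0 \<in> polys_in W"
  by (simp add: polys_in_def)

lemma ratfuns_in_Fract:
  assumes "a \<in> polys_in W" "b \<in> polys_in W"
  shows "Fract a b \<in> ratfuns_in W"
proof (cases "b = 0")
  \<comment> \<open>A library fraction with denominator 0 equals 0, which has the admissible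
    representation \<open>Fract 0 1\<close>.\<close>
  case True
  then have "Fract a b = Fract 0 1" by (simp add: eq_fract)
  then show ?thesis unfolding ratfuns_in_def using polys_in_0 polys_in_1 by fastforce
qed (use assms in \<open>auto simp: ratfuns_in_def\<close>)

lemma ratfuns_inE:
  assumes "f \<in> ratfuns_in W"
  obtains a b where "f = Fract a b" "a \<in> polys_in W" "b \<in> polys_in W" "b \<noteq> 0"
  using assms unfolding ratfuns_in_def by blast

lemma ratfuns_in_add:
  assumes "f \<in> ratfuns_in W" "g \<in> ratfuns_in W"
  shows "f + g \<in> ratfuns_in W"
  using assms
  by (elim ratfuns_inE) (simp add: ratfuns_in_Fract polys_in_add polys_in_mult)

lemma ratfuns_in_mult:
  assumes "f \<in> ratfuns_in W" "g \<in> ratfuns_in W"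
  shows "f * g \<in> ratfuns_in W"
  using assms
  by (elim ratfuns_inE) (simp add: ratfuns_in_Fract polys_in_mult)

lemma ratfuns_in_const: "of_rat a \<in> ratfuns_in W"
  by (simp add: ratfuns_in_Fract polys_in_const polys_in_1 flip: Fract_const)

lemma ratfuns_in_inverse: "f \<in> ratfuns_in W \<Longrightarrow> inverse f \<in> ratfuns_in W"
  by (elim ratfuns_inE) (simp add: ratfuns_in_Fract)

lemma ratfuns_in_minus: "f \<in> ratfuns_in W \<Longrightarrow> - f \<in> ratfuns_in W"
  using ratfuns_in_mult[OF ratfuns_in_const[of "-1"], of f] by simp

lemma ratfuns_in_diff: "f \<in> ratfuns_in W \<Longrightarrow> g \<in> ratfuns_in W \<Longrightarrow> f - g \<in> ratfuns_in W"
  using ratfuns_in_add[OF _ ratfuns_in_minus, of f W g] by simp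

lemma ratfuns_in_divide: "f \<in> ratfuns_in W \<Longrightarrow> g \<in> ratfuns_in W \<Longrightarrow> f / g \<in> ratfuns_in W"
  by (simp add: divide_inverse ratfuns_in_mult ratfuns_in_inverse)

lemma ratfuns_in_power: "f \<in> ratfuns_in W \<Longrightarrow> f ^ n \<in> ratfuns_in W"
  by (induction n) (use ratfuns_in_const[of 1] in \<open>simp_all add: ratfuns_in_mult\<close>)

lemma ratfuns_in_rvar: "v \<in> W \<Longrightarrow> rvar v \<in> ratfuns_in W"
  unfolding rvar_def by (rule ratfuns_in_Fract) (simp_all add: Var_def polys_in_def)

lemma ratfuns_in_peval:
  assumes "p \<in> polys_in V" "\<And>v. v \<in> V \<Longrightarrow> \<sigma> v \<in> ratfuns_in W"
  shows "peval \<sigma> p \<in> ratfuns_in W"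
proof -
  have zero: "0 \<in> ratfuns_in W" and one: "1 \<in> ratfuns_in W"
    using ratfuns_in_const[of 0] ratfuns_in_const[of 1] by simp_all
  have "(\<Prod>v\<in>A. \<sigma> v ^ n v) \<in> ratfuns_in W" if "A \<subseteq> V" for A n
    using that
    by (induction A rule: infinite_finite_induct)
      (simp_all add: one assms(2) ratfuns_in_mult ratfuns_in_power)
  moreover have "Poly_Mapping.keys k \<subseteq> V" if "k \<in> Poly_Mapping.keys p" for k
    using assms(1) that by (auto simp: polys_in_def)
  moreover have "sum f A \<in> ratfuns_in W" if "\<And>k. k \<in> A \<Longrightarrow> f k \<in> ratfuns_in W" for f and A :: "(pvar \<Rightarrow>\<^sub>0 nat) set"
    using that by (induction A rule: infinite_finite_induct) (simp_all add: zero ratfuns_in_add)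
  ultimately show ?thesis
    unfolding peval_def by (simp add: ratfuns_in_mult ratfuns_in_const)
qed

section \<open>Pullback along dominant maps\<close>

lemma
  shows map_subst_x3 [simp]: "map_subst g V_x3 = fst g"
    and map_subst_x4 [simp]: "map_subst g V_x4 = snd g"
    and map_subst_other: "v \<noteq> V_x3 \<Longrightarrow> v \<noteq> V_x4 \<Longrightarrow> map_subst g v = rvar v"
  by (simp_all add: map_subst_def)

lemma reval_map_subst:
  "reval (map_subst h) (map_subst g v) = map_subst (ratmap_comp g h) v"
  by (simp add: map_subst_def ratmap_comp_def)

text \<open>Dominance of \<open>h\<close> keeps nonzero polynomials in the two coordinates nonzero,
  denominators in particular. Substituting \<open>h\<close> is therefore defined on all rational
  functions of the plane and sends only 0 to 0.\<close>

lemma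
  assumes "dominant h" "f \<in> ratfuns_in {V_x3, V_x4}"
  shows dominant_rdefined: "rdefined (map_subst h) f"
    and dominant_reval_in: "reval (map_subst h) f \<in> ratfuns_in {V_x3, V_x4}"
    and dominant_reval_nonzero: "f \<noteq> 0 \<Longrightarrow> reval (map_subst h) f \<noteq> 0"
proof -
  obtain a b where f: "f = Fract a b" and ab: "a \<in> polys_in {V_x3, V_x4}" "b \<in> polys_in {V_x3, V_x4}" "b \<noteq> 0"
    using assms(2) by (rule ratfuns_inE)
  have b: "peval (map_subst h) b \<noteq> 0"
    using assms(1) ab by (simp add: dominant_def)
  then show "rdefined (map_subst h) f" by (simp add: f rdefined_Fract)
  have "peval (map_subst h) q \<in> ratfuns_in {V_x3, V_x4}" if "q \<in> polys_in {V_x3, V_x4}" for q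
    using assms(1) by (intro ratfuns_in_peval[OF that]) (auto simp: dominant_def)
  then show "reval (map_subst h) f \<in> ratfuns_in {V_x3, V_x4}"
    by (simp add: f reval_Fract b ratfuns_in_divide ab)
  assume "f \<noteq> 0"
  then have "a \<noteq> 0" by (auto simp: f fract_collapse)
  then show "reval (map_subst h) f \<noteq> 0"
    using assms(1) ab b by (simp add: f reval_Fract dominant_def)
qed

lemma dominant_rdefined_map_subst:
  assumes "dominant g" "dominant h"
  shows "rdefined (map_subst h) (map_subst g v)"
  using assms dominant_rdefined[OF assms(2)] by (auto simp: map_subst_def dominant_def)

text \<open>Substituting the composite means substituting \<open>g\<close> and then
  \<open>h\<close>, and neither step sends a nonzero element to 0.\<close>

lemma dominant_comp:
  assumes "dominant g" "dominant h"
  shows "dominant (ratmap_comp g h)"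
  unfolding dominant_def
proof (intro conjI ballI impI)
  fix p :: mpol assume p: "p \<in> polys_in {V_x3, V_x4}" "p \<noteq> 0"
  have "peval (map_subst (ratmap_comp g h)) p = reval (map_subst h) (peval (map_subst g) p)"
    using dominant_rdefined_map_subst[OF assms] by (simp add: reval_peval reval_map_subst)
  moreover have "peval (map_subst g) p \<in> ratfuns_in {V_x3, V_x4}"
    using assms(1) by (intro ratfuns_in_peval[OF p(1)]) (auto simp: dominant_def)
  ultimately show "peval (map_subst (ratmap_comp g h)) p \<noteq> 0"
    using dominant_reval_nonzero[OF assms(2)] assms(1) p by (simp add: dominant_def)
qed (use assms dominant_reval_in[OF assms(2)] in \<open>auto simp: dominant_def ratmap_comp_def\<close>)

text \<open>Pullback reverses composition; applied to the coordinates of a third map this is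
  associativity.\<close>

lemma reval_ratmap_comp:
  assumes "dominant g" "dominant h" "f \<in> ratfuns_in {V_x3, V_x4}"
  shows "reval (map_subst h) (reval (map_subst g) f) = reval (map_subst (ratmap_comp g h)) f"
proof -
  obtain a b where f: "f = Fract a b" and ab: "a \<in> polys_in {V_x3, V_x4}" "b \<in> polys_in {V_x3, V_x4}" "b \<noteq> 0"
    using assms(3) by (rule ratfuns_inE)
  have nz: "peval (map_subst g) b \<noteq> 0" "peval (map_subst (ratmap_comp g h)) b \<noteq> 0"
    using assms dominant_comp[OF assms(1,2)] ab by (simp_all add: dominant_def)
  have peval: "rdefined (map_subst h) (peval (map_subst g) q)"
    "reval (map_subst h) (peval (map_subst g) q) = peval (map_subst (ratmap_comp g h)) q" for q
    using dominant_rdefined_map_subst[OF assms(1,2)]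
    by (simp_all add: rdefined_peval reval_peval reval_map_subst)
  show ?thesis
    using nz by (simp add: f reval_Fract reval_divide peval)
qed

lemma map_subst_one: "map_subst (rvar V_x3, rvar V_x4) = rvar"
  by (auto simp: map_subst_def)

lemma dominant_one: "dominant (rvar V_x3, rvar V_x4)"
  unfolding dominant_def map_subst_one
  by (auto simp: ratfuns_in_rvar peval_rvar Zero_fract_def eq_fract)

lemma reval_rvar_self: "reval rvar f = f"
  by (cases f) (simp add: reval_Fract peval_rvar Zero_fract_def eq_fract)

lemma ratmap_monoid: "monoid ratmap_monoid"
proof
  fix g h k assume "g \<in> carrier ratmap_monoid" "h \<in> carrier ratmap_monoid" "k \<in> carrier ratmap_monoid"
  then have d: "dominant g" "dominant h" "dominant k" by (simp_all add: ratmap_monoid_def)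
  then have "fst g \<in> ratfuns_in {V_x3, V_x4}" "snd g \<in> ratfuns_in {V_x3, V_x4}"
    by (simp_all add: dominant_def)
  with reval_ratmap_comp[OF d(2,3)]
  show "g \<otimes>\<^bsub>ratmap_monoid\<^esub> h \<otimes>\<^bsub>ratmap_monoid\<^esub> k = g \<otimes>\<^bsub>ratmap_monoid\<^esub> (h \<otimes>\<^bsub>ratmap_monoid\<^esub> k)"
    by (simp add: ratmap_monoid_def ratmap_comp_def)
qed (auto simp: ratmap_monoid_def dominant_comp dominant_one map_subst_one reval_rvar_self
    ratmap_comp_def[of "(rvar V_x3, rvar V_x4)"] ratmap_comp_def[of _ "(rvar V_x3, rvar V_x4)"])

section \<open>Renormalized configurations\<close>

text \<open>
  A pair \<open>(x\<^sub>3, x\<^sub>4)\<close> encodes the configuration \<open>(-1, 1, x\<^sub>3, x\<^sub>4)\<close>. Relabelling the first three points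
  by a permutation and restoring the normalization \<open>(-1, 1)\<close> of the first two by an affine map
  gives a new pair.
\<close>

definition config :: "'a \<times> 'a \<Rightarrow> nat \<Rightarrow> 'a::field_char_0" where
  "config P i = (if i = 1 then - 1 else if i = 2 then 1 else if i = 3 then fst P else snd P)"

text \<open>This is the affine map that takes \<open>z 1\<close> to -1 and \<open>z 2\<close> to 1,
  applied to every point.\<close>

definition renormalize :: "(nat \<Rightarrow> 'a) \<Rightarrow> nat \<Rightarrow> 'a::field_char_0" where
  "renormalize z i = (2 * z i - z 1 - z 2) / (z 2 - z 1)"

definition relabel :: "(nat \<Rightarrow> nat) \<Rightarrow> 'a \<times> 'a \<Rightarrow> 'a \<times> 'a::field_char_0" where
  "relabel p P = (renormalize (config P \<circ> p) 3, renormalize (config P \<circ> p) 4)"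

lemma config_simps [simp]:
  "config P (Suc 0) = -1" "config P 1 = -1" "config P 2 = 1" "config P 3 = fst P" "config P 4 = snd P"
  by (simp_all add: config_def)

lemma nat_interval_3: "{1..3} = {1, 2, 3 :: nat}"
  by auto

lemma nat_interval_4: "{1..4} = {1, 2, 3, 4 :: nat}"
  by auto

lemma inj_on_config_4: "inj_on (config P) {1..4} \<longleftrightarrow> distinct [-1, 1, fst P, snd P]"
  unfolding nat_interval_4 by auto

lemma inj_on_config_subset: "inj_on (config P) {1..4} \<Longrightarrow> inj_on (config P) {1..3}"
  by (rule inj_on_subset) auto

lemma inj_on_permuted:
  assumes "inj_on z {1..3::nat}" "p permutes {1..3}" "i \<in> {1..3}" "j \<in> {1..3}" "i \<noteq> j"
  shows "z (p i) \<noteq> z (p j)"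
  using assms permutes_in_image[OF assms(2)] permutes_inj[OF assms(2)]
  by (metis inj_onD injD)

lemma renormalize_diff: "renormalize z i - renormalize z j = 2 * (z i - z j) / (z 2 - z 1)"
  unfolding renormalize_def by (simp add: algebra_simps flip: diff_divide_distrib)

text \<open>Normalizing depends only on quotients of differences. The inner normalization multiplies
  all differences by the same factor, which cancels.\<close>

lemma renormalize_renormalize:
  assumes "z 1 \<noteq> z 2" "z (q 1) \<noteq> z (q 2)"
  shows "renormalize (renormalize z \<circ> q) = renormalize (z \<circ> q)"
proof
  fix i
  define d where "d = z 2 - z 1"
  define e where "e = z (q 2) - z (q 1)"
  have de: "d \<noteq> 0" "e \<noteq> 0" using assms by (auto simp: d_def e_def)
  have diff: "renormalize z j - renormalize z k = 2 * (z j - z k) / d" for j k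
    by (simp add: renormalize_diff d_def)
  have "renormalize (renormalize z \<circ> q) i =
      ((renormalize z (q i) - renormalize z (q 1)) + (renormalize z (q i) - renormalize z (q 2)))
      / (renormalize z (q 2) - renormalize z (q 1))"
    by (simp add: renormalize_def[of "renormalize z \<circ> q"] algebra_simps)
  also have "\<dots> = ((z (q i) - z (q 1)) + (z (q i) - z (q 2))) / e"
  proof -
    have "(2 * a / d + 2 * b / d) / (2 * e / d) = (a + b) / e" for a b
      using de by (simp add: field_simps)
    then show ?thesis
      unfolding diff e_def[symmetric] .
  qed
  also have "\<dots> = renormalize (z \<circ> q) i"
    by (simp add: renormalize_def e_def algebra_simps)
  finally show "renormalize (renormalize z \<circ> q) i = renormalize (z \<circ> q) i" .
qed

text \<open>Equality as functions of the index allows a further permutation to be composed on the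
  right, so that successive relabellings can be computed.\<close>

lemma config_relabel:
  assumes "inj_on (config P) {1..3}" "p permutes {1..3}"
  shows "config (relabel p P) = renormalize (config P \<circ> p)"
proof
  fix i :: nat
  have p4: "p j = j" if "j \<notin> {1..3}" for j
    using assms(2) that by (simp add: permutes_def)
  have "config P (p 1) \<noteq> config P (p 2)"
    by (rule inj_on_permuted[OF assms]) auto
  then have "config P (p 2) - config P (p 1) \<noteq> 0" by simp
  then have 12: "renormalize (config P \<circ> p) 1 = -1" "renormalize (config P \<circ> p) 2 = 1"
    by (auto simp: renormalize_def field_simps)
  \<comment> \<open>\<open>config\<close> gives every index outside 1, 2, 3 the fourth position, so
    the equality of functions has to be checked there too.\<close>
  have other: "renormalize (config P \<circ> p) i = renormalize (config P \<circ> p) 4" if "i \<notin> {1..3}"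
  proof -
    have "config P i = snd P" using that by (auto simp: config_def)
    then show ?thesis using that p4[of i] p4[of 4] by (simp add: renormalize_def)
  qed
  consider "i = 1" | "i = 2" | "i = 3" | "i \<notin> {1..3}" by fastforce
  then show "config (relabel p P) i = renormalize (config P \<circ> p) i"
    using 12 other by cases (auto simp: config_def relabel_def)
qed

text \<open>Relabelling is a right action: permutations act by precomposition, and the intermediate
  normalization is absorbed by the last one.\<close>

lemma relabel_relabel:
  assumes "inj_on (config P) {1..3}" "p permutes {1..3}" "q permutes {1..3}"
  shows "relabel q (relabel p P) = relabel (p \<circ> q) P"
proof -
  have "config P (p 1) \<noteq> config P (p 2)" "config P (p (q 1)) \<noteq> config P (p (q 2))"
    using inj_on_permuted[OF assms(1,2), of 1 2]
      inj_on_permuted[OF assms(1) permutes_compose[OF assms(3,2)], of 1 2] by auto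
  then show ?thesis
    by (simp add: relabel_def[of q] relabel_def[of "p \<circ> q"] config_relabel[OF assms(1,2)]
        renormalize_renormalize comp_assoc)
qed

lemma relabel_id: "relabel id P = P"
  by (simp add: relabel_def renormalize_def)

text \<open>The set \<open>S\<close> is kept general because distinctness is needed both for the
  three permuted points and for all four.\<close>

lemma inj_on_relabel:
  assumes "inj_on (config P) S" "inj_on (config P) {1..3}" "p permutes {1..3}" "p permutes S"
  shows "inj_on (config (relabel p P)) S"
proof (rule inj_onI)
  fix i j assume ij: "i \<in> S" "j \<in> S" "config (relabel p P) i = config (relabel p P) j"
  have "config P (p 2) - config P (p 1) \<noteq> 0"
    using inj_on_permuted[OF assms(2,3), of 1 2] by auto
  with ij(3) have "config P (p i) = config P (p j)"
    by (simp add: config_relabel[OF assms(2,3)] renormalize_def)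
  moreover have "p i \<in> S" "p j \<in> S" using ij assms(4) by (simp_all add: permutes_in_image)
  ultimately show "i = j"
    using assms(1) permutes_inj[OF assms(4)] by (meson inj_onD injD)
qed

text \<open>
  If two relabellings agree, the differences \<open>x\<^sub>i - x\<^sub>4\<close>, \<open>i \<le> 3\<close>, are permuted up to a factor \<open>A\<close>.
  Comparing their products gives \<open>A\<^sup>3 = 1\<close>, so \<open>A = 1\<close> over the reals.
\<close>

lemma relabel_inj:
  fixes P :: "real \<times> real"
  assumes inj: "inj_on (config P) {1..4}" and p: "p permutes {1..3}" and q: "q permutes {1..3}"
    and eq: "relabel p P = relabel q P"
  shows "p = q"
proof -
  note inj3 = inj_on_config_subset[OF inj]
  define y where "y i = config P i - snd P" for i
  \<comment> \<open>Each normalization divides differences by the signed distance of its first two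
    points; \<open>A\<close> is the quotient of these distances.\<close>
  define A where "A = (config P (p 2) - config P (p 1)) / (config P (q 2) - config P (q 1))"
  have d: "config P (p 2) - config P (p 1) \<noteq> 0" "config P (q 2) - config P (q 1) \<noteq> 0"
    using inj_on_permuted[OF inj3 p, of 1 2] inj_on_permuted[OF inj3 q, of 1 2] by auto
  have fix4: "p 4 = 4" "q 4 = 4" using p q by (simp_all add: permutes_def)
  have y: "y (p i) = A * y (q i)" for i
  proof -
    have "renormalize (config P \<circ> r) i - renormalize (config P \<circ> r) 4 =
        2 * y (r i) / (config P (r 2) - config P (r 1))" if "r \<in> {p, q}" for r
      using that fix4 by (auto simp: renormalize_diff y_def)
    moreover have "renormalize (config P \<circ> p) j = renormalize (config P \<circ> q) j" for j
      using eq config_relabel[OF inj3 p] config_relabel[OF inj3 q] by metis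
    ultimately have "2 * y (p i) / (config P (p 2) - config P (p 1)) =
        2 * y (q i) / (config P (q 2) - config P (q 1))" by (metis insertI1 insertI2)
    then show ?thesis using d by (simp add: A_def field_simps)
  qed
  have y_nz: "y i \<noteq> 0" if "i \<in> {1..3}" for i
  proof -
    have "config P i \<noteq> config P 4" using that inj_onD[OF inj, of i 4] by fastforce
    then show ?thesis by (simp add: y_def)
  qed
  have "(\<Prod>i\<in>{1..3}. y i) = (\<Prod>i\<in>{1..3}. y (p i))"
    using prod.permute[OF p, of y] by (simp add: o_def)
  also have "\<dots> = A ^ 3 * (\<Prod>i\<in>{1..3}. y (q i))"
    by (simp add: y prod.distrib)
  also have "(\<Prod>i\<in>{1..3}. y (q i)) = (\<Prod>i\<in>{1..3}. y i)"
    using prod.permute[OF q, of y] by (simp add: o_def)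
  finally have "A ^ 3 = 1" using y_nz by simp
  moreover have "A ^ 3 < 0" if "A < 0" using that by (simp add: power_less_zero_eq)
  ultimately have "A = 1"
    using power_eq_imp_eq_base[of A 3 1] by fastforce
  then have same: "config P (p i) = config P (q i)" for i
    using y[of i] by (simp add: y_def)
  show "p = q"
  proof
    fix i
    show "p i = q i"
    proof (cases "i \<in> {1..3}")
      case True
      then have "p i \<in> {1..3}" "q i \<in> {1..3}" using p q by (simp_all only: permutes_in_image)
      with same[of i] show ?thesis using inj_onD[OF inj3] by blast
    next
      case False
      with p q show ?thesis by (simp add: permutes_def)
    qed
  qed
qed

section \<open>The equations of relative equilibrium\<close>

text \<open>
  The \<open>i\<close>-th equation at the configuration \<open>z\<close>. In this form the four equations of the paper become
  uniform in the index: those for \<open>i \<le> 3\<close> are exchanged by a permutation of the first three vortices.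
\<close>

definition equilibrium :: "'a \<Rightarrow> 'a \<Rightarrow> 'a \<Rightarrow> (nat \<Rightarrow> 'a) \<Rightarrow> nat \<Rightarrow> 'a::field_char_0" where
  "equilibrium m \<omega> c z i = \<omega> * (z i - c) + (\<Sum>j\<in>{1..4} - {i}. (if j = 4 then m else 1) / (z j - z i))"

lemma equilibrium_expand:
  "equilibrium m \<omega> c z 1 = \<omega> * (z 1 - c) + 1 / (z 2 - z 1) + 1 / (z 3 - z 1) + m / (z 4 - z 1)"
  "equilibrium m \<omega> c z 2 = \<omega> * (z 2 - c) + 1 / (z 1 - z 2) + 1 / (z 3 - z 2) + m / (z 4 - z 2)"
  "equilibrium m \<omega> c z 3 = \<omega> * (z 3 - c) + 1 / (z 1 - z 3) + 1 / (z 2 - z 3) + m / (z 4 - z 3)"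
  "equilibrium m \<omega> c z 4 = \<omega> * (z 4 - c) + 1 / (z 1 - z 4) + 1 / (z 2 - z 4) + 1 / (z 3 - z 4)"
proof -
  have "{1..4} - {1} = {2, 3, 4::nat}" "{1..4} - {2} = {1, 3, 4::nat}"
    "{1..4} - {3} = {1, 2, 4::nat}" "{1..4} - {4} = {1, 2, 3::nat}" by auto
  then show
    "equilibrium m \<omega> c z 1 = \<omega> * (z 1 - c) + 1 / (z 2 - z 1) + 1 / (z 3 - z 1) + m / (z 4 - z 1)"
    "equilibrium m \<omega> c z 2 = \<omega> * (z 2 - c) + 1 / (z 1 - z 2) + 1 / (z 3 - z 2) + m / (z 4 - z 2)"
    "equilibrium m \<omega> c z 3 = \<omega> * (z 3 - c) + 1 / (z 1 - z 3) + 1 / (z 2 - z 3) + m / (z 4 - z 3)"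
    "equilibrium m \<omega> c z 4 = \<omega> * (z 4 - c) + 1 / (z 1 - z 4) + 1 / (z 2 - z 4) + 1 / (z 3 - z 4)"
    by (simp_all add: equilibrium_def)
qed

text \<open>The sum is reindexed by \<open>p\<close>. The circulations are preserved because
  \<open>p\<close> fixes 4, the only index with circulation \<open>m\<close>.\<close>

lemma equilibrium_permuted:
  assumes p: "p permutes {1..3}" and i: "i \<in> {1..4}"
  shows "equilibrium m \<omega> c (z \<circ> p) i = equilibrium m \<omega> c z (p i)"
proof -
  have p4: "p permutes {1..4}" by (rule permutes_subset[OF p]) auto
  then have "bij_betw p {1..4} {1..4}" by (rule permutes_imp_bij)
  then have bij: "bij_betw p ({1..4} - {i}) ({1..4} - {p i})"
    by (rule bij_betw_DiffI) (use i permutes_in_image[OF p4, of i] in auto)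
  have "p 4 = 4" using p by (simp add: permutes_def)
  then have "p j = 4 \<longleftrightarrow> j = 4" for j using permutes_inj[OF p] by (metis injD)
  then show ?thesis
    using sum.reindex_bij_betw[OF bij, of "\<lambda>j. (if j = 4 then m else 1) / (z j - z (p i))"]
    by (simp add: equilibrium_def)
qed

text \<open>Put \<open>d = (z 2 - z 1) / 2\<close>. Normalizing divides differences by
  \<open>d\<close>, so the reciprocals gain a factor \<open>d\<close>; multiplying
  \<open>\<omega>\<close> by the square of \<open>d\<close> and moving \<open>c\<close> along with
  the points gives the linear term the same factor.\<close>

lemma equilibrium_renormalize:
  assumes "z 1 \<noteq> z 2"
  shows "equilibrium m (\<omega> * ((z 2 - z 1) / 2)\<^sup>2) ((2 * c - z 1 - z 2) / (z 2 - z 1)) (renormalize z) i =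
    (z 2 - z 1) / 2 * equilibrium m \<omega> c z i"
proof -
  define d where "d = (z 2 - z 1) / 2"
  have d: "d \<noteq> 0" "z 2 - z 1 = 2 * d" using assms by (auto simp: d_def)
  have diff: "renormalize z j - renormalize z i = (z j - z i) / d" for j
    using d by (simp add: renormalize_def field_simps)
  have diff_c: "renormalize z i - (2 * c - z 1 - z 2) / (2 * d) = (z i - c) / d"
    using d by (simp add: renormalize_def field_simps)
  show ?thesis
    unfolding equilibrium_def diff d(2) diff_c using d
    by (simp add: power2_eq_square distrib_left sum_distrib_left mult.commute)
qed

text \<open>The two forms of the equations differ in the orientation of some differences; the
  constants 1/2 and -1/2 are the interaction of the vortices at -1 and 1.\<close>

lemma is_solution_iff:
  "is_solution m \<omega> c P \<longleftrightarrow>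
    inj_on (config P) {1..4} \<and> (\<forall>i\<in>{1..4}. equilibrium m \<omega> c (config P) i = 0)"
proof -
  obtain a b where P: "P = (a, b)" by (cases P)
  have "distinct [-1, 1, a, b] \<Longrightarrow> 1 / (-1 - a) = - 1 / (a + 1) \<and> 1 / (1 - a) = - 1 / (a - 1) \<and>
      1 / (-1 - b) = - 1 / (b + 1) \<and> 1 / (1 - b) = - 1 / (b - 1) \<and> 1 / (a - b) = - 1 / (b - a)"
    by (auto simp: field_simps)
  moreover have "1 / (-1 - 1) = - 1 / (2::real)" by simp
  ultimately show ?thesis
    unfolding inj_on_config_4 unfolding nat_interval_4 is_solution_def P
    by (auto simp: equilibrium_expand simp del: One_nat_def)
qed

lemma is_position_relabel:
  assumes "is_position m P" "p permutes {1..3}"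
  shows "is_position m (relabel p P)"
proof -
  obtain \<omega> c where "is_solution m \<omega> c P"
    using assms(1) by (auto simp: is_position_def)
  then have inj: "inj_on (config P) {1..4}"
    and eq: "\<And>i. i \<in> {1..4} \<Longrightarrow> equilibrium m \<omega> c (config P) i = 0"
    by (auto simp: is_solution_iff)
  note inj3 = inj_on_config_subset[OF inj]
  have p4: "p permutes {1..4}" by (rule permutes_subset[OF assms(2)]) auto
  let ?z = "config P \<circ> p"
  have "?z 1 \<noteq> ?z 2" using inj_on_permuted[OF inj3 assms(2), of 1 2] by simp
  note renorm = equilibrium_renormalize[OF this]
  \<comment> \<open>The new angular velocity and center are those supplied by
    \<open>equilibrium_renormalize\<close>.\<close>
  have "equilibrium m (\<omega> * ((?z 2 - ?z 1) / 2)\<^sup>2) ((2 * c - ?z 1 - ?z 2) / (?z 2 - ?z 1))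
      (config (relabel p P)) i = 0" if "i \<in> {1..4}" for i
    unfolding config_relabel[OF inj3 assms(2)]
    using renorm equilibrium_permuted[OF assms(2) that] eq[of "p i"] permutes_in_image[OF p4] that
    by (metis mult_zero_right)
  then have "\<exists>\<omega>' c'. \<forall>i\<in>{1..4}. equilibrium m \<omega>' c' (config (relabel p P)) i = 0" by blast
  then show ?thesis
    using inj_on_relabel[OF inj inj3 assms(2) p4] by (simp add: is_position_def is_solution_iff)
qed

section \<open>Invariance of the elimination ideal\<close>

lemma module_mpol: "module ((*) :: mpol \<Rightarrow> mpol \<Rightarrow> mpol)"
  by standard (simp_all add: algebra_simps)

lemma vortex_ideal_mult: "p \<in> vortex_ideal \<Longrightarrow> q * p \<in> vortex_ideal"
  unfolding vortex_ideal_def by (rule module.span_scale[OF module_mpol])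

lemma vortex_ideal_mult_right: "p \<in> vortex_ideal \<Longrightarrow> p * q \<in> vortex_ideal"
  using vortex_ideal_mult[of p q] by (simp add: mult.commute)

lemma vortex_ideal_add: "p \<in> vortex_ideal \<Longrightarrow> q \<in> vortex_ideal \<Longrightarrow> p + q \<in> vortex_ideal"
  unfolding vortex_ideal_def by (rule module.span_add[OF module_mpol])

lemma vortex_ideal_diff: "p \<in> vortex_ideal \<Longrightarrow> q \<in> vortex_ideal \<Longrightarrow> p - q \<in> vortex_ideal"
  unfolding vortex_ideal_def by (rule module.span_diff[OF module_mpol])

lemma vortex_ideal_0: "0 \<in> vortex_ideal"
  unfolding vortex_ideal_def by (rule module.span_zero[OF module_mpol])

lemma generators_in_vortex_ideal: "f \<in> {f1, f2, f3, f4, f5, f6} \<Longrightarrow> f \<in> vortex_ideal"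
  unfolding vortex_ideal_def by (rule module.span_base[OF module_mpol])

text \<open>Requiring \<open>b \<noteq> 0\<close> lets these elements serve as denominators without
  first showing that the ideal is proper.\<close>

definition ideal_units :: "mpol set" where
  "ideal_units = {b. b \<noteq> 0 \<and> (\<exists>c. b * c - 1 \<in> vortex_ideal)}"

lemma ideal_units_nonzero: "b \<in> ideal_units \<Longrightarrow> b \<noteq> 0"
  by (simp add: ideal_units_def)

lemma ideal_units_1: "1 \<in> ideal_units"
proof -
  have "1 \<noteq> (0 :: mpol)" "1 * 1 - 1 \<in> vortex_ideal" using vortex_ideal_0 by simp_all
  then show ?thesis unfolding ideal_units_def by blast
qed

text \<open>A divisor of a unit modulo the ideal is itself a unit; \<open>c\<close> times an inverse
  of \<open>w\<close> inverts \<open>b\<close>.\<close>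

lemma ideal_units_dvd:
  assumes "b \<noteq> 0" "b * c - w \<in> vortex_ideal" "w \<in> ideal_units"
  shows "b \<in> ideal_units"
proof -
  obtain d where d: "w * d - 1 \<in> vortex_ideal" using assms(3) by (auto simp: ideal_units_def)
  have "b * (c * d) - 1 = (b * c - w) * d + (w * d - 1)" by (simp add: algebra_simps)
  then have "b * (c * d) - 1 \<in> vortex_ideal"
    using d assms(2) by (simp only: vortex_ideal_add vortex_ideal_mult_right)
  with assms(1) show ?thesis unfolding ideal_units_def by blast
qed

lemma ideal_units_mult:
  assumes "b \<in> ideal_units" "w \<in> ideal_units"
  shows "b * w \<in> ideal_units"
proof -
  obtain c where "b * c - 1 \<in> vortex_ideal" using assms(1) by (auto simp: ideal_units_def)
  then have "(b * c - 1) * w \<in> vortex_ideal" by (rule vortex_ideal_mult_right)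
  moreover have "(b * c - 1) * w = b * w * c - w" by (simp add: algebra_simps)
  ultimately have "b * w * c - w \<in> vortex_ideal" by simp
  moreover have "b * w \<noteq> 0" using assms by (simp add: ideal_units_nonzero)
  ultimately show ?thesis using ideal_units_dvd assms(2) by blast
qed

text \<open>Polynomials are shown to be nonzero by giving one point where they do not
  vanish.\<close>

lemma peval_nonzeroD: "peval \<sigma> p \<noteq> 0 \<Longrightarrow> p \<noteq> 0"
  by auto

lemma ideal_units_2: "2 \<in> ideal_units"
proof -
  have "2 * Poly_Mapping.single 0 (1 / 2) - 1 = (0 :: mpol)"
  proof -
    have "2 * Poly_Mapping.single 0 (1 / 2) = Poly_Mapping.single 0 2 * (Poly_Mapping.single 0 (1 / 2) :: mpol)"
      by (simp only: single_numeral)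
    also have "\<dots> = 1" by (simp only: mult_single) simp
    finally show ?thesis by simp
  qed
  with vortex_ideal_0 have "2 * Poly_Mapping.single 0 (1 / 2) - 1 \<in> vortex_ideal" by simp
  moreover have "2 \<noteq> (0 :: mpol)" by simp
  ultimately show ?thesis unfolding ideal_units_def by blast
qed

lemma ideal_units_x4:
  "Var V_x4 - 1 \<in> ideal_units" "Var V_x4 + 1 \<in> ideal_units"
proof -
  have "(Var V_x4 - 1) * Var V_u - 1 = f5" "(Var V_x4 + 1) * Var V_v - 1 = f6"
    by (simp_all add: f5_def f6_def algebra_simps)
  then have "(Var V_x4 - 1) * Var V_u - 1 \<in> vortex_ideal" "(Var V_x4 + 1) * Var V_v - 1 \<in> vortex_ideal"
    using generators_in_vortex_ideal by simp_all
  moreover have "Var V_x4 - 1 \<noteq> 0" "Var V_x4 + 1 \<noteq> 0"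
    by (rule peval_nonzeroD[of "\<lambda>_. 2::real"], simp add: peval_hom)+
  ultimately show "Var V_x4 - 1 \<in> ideal_units" "Var V_x4 + 1 \<in> ideal_units"
    unfolding ideal_units_def by blast+
qed

text \<open>
  Modulo \<open>x\<^sub>3 + 1\<close>, \<open>x\<^sub>3 - 1\<close> and \<open>x\<^sub>4 - x\<^sub>3\<close>, the generators \<open>f\<^sub>1\<close>, \<open>f\<^sub>2\<close> and \<open>f\<^sub>4\<close> reduce to units, so all
  differences of positions are invertible modulo the ideal, not only those covered by \<open>u\<close> and \<open>v\<close>.
\<close>

lemma ideal_units_x3:
  "Var V_x3 + 1 \<in> ideal_units" "Var V_x3 - 1 \<in> ideal_units" "Var V_x4 - Var V_x3 \<in> ideal_units"
proof -
  let ?b = "Var V_x3 + 1" and ?b' = "Var V_x3 - 1" and ?b'' = "Var V_x4 - Var V_x3"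
  have nz: "?b \<noteq> 0" "?b' \<noteq> 0"
    by (rule peval_nonzeroD[of "\<lambda>_. 2::real"], simp add: peval_hom)+
  have nz'': "?b'' \<noteq> 0"
    by (rule peval_nonzeroD[of "\<lambda>v. if v = V_x4 then 1 else 0 :: real"]) (simp add: peval_hom)
  \<comment> \<open>Up to sign this is the cofactor of \<open>?b\<close> in \<open>f1\<close>; the
    terms of \<open>f1\<close> without that factor add up to \<open>2 * (Var V_x4 + 1)\<close>, a
    known unit.\<close>
  define c where "c = - (2 * Var V_omega * (- 1 - Var V_c) * (Var V_x4 + 1) + (Var V_x4 + 1) + 2 * Var V_m)"
  have "?b * c - 2 * (Var V_x4 + 1) = 0 - f1"
    unfolding c_def f1_def by (simp add: algebra_simps)
  then have "?b * c - 2 * (Var V_x4 + 1) \<in> vortex_ideal"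
    using vortex_ideal_diff[OF vortex_ideal_0] generators_in_vortex_ideal by simp
  then show "?b \<in> ideal_units"
    by (rule ideal_units_dvd[OF nz(1)]) (intro ideal_units_mult ideal_units_2 ideal_units_x4)
  define c' where "c' = - (2 * Var V_omega * (1 - Var V_c) * (Var V_x4 - 1) - (Var V_x4 - 1) + 2 * Var V_m)"
  have "?b' * c' - 2 * (Var V_x4 - 1) = 0 - f2"
    unfolding c'_def f2_def by (simp add: algebra_simps)
  then have "?b' * c' - 2 * (Var V_x4 - 1) \<in> vortex_ideal"
    using vortex_ideal_diff[OF vortex_ideal_0] generators_in_vortex_ideal by simp
  then show "?b' \<in> ideal_units"
    by (rule ideal_units_dvd[OF nz(2)]) (intro ideal_units_mult ideal_units_2 ideal_units_x4)
  define c'' where "c'' = Var V_omega * (Var V_x4 - Var V_c) * (Var V_x4 + 1) * (Var V_x4 - 1)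
      - (Var V_x4 - 1) - (Var V_x4 + 1)"
  have "?b'' * c'' - (Var V_x4 + 1) * (Var V_x4 - 1) = f4"
    unfolding c''_def f4_def by (simp add: algebra_simps)
  then have "?b'' * c'' - (Var V_x4 + 1) * (Var V_x4 - 1) \<in> vortex_ideal"
    using generators_in_vortex_ideal by simp
  then show "?b'' \<in> ideal_units"
    by (rule ideal_units_dvd[OF nz'']) (intro ideal_units_mult ideal_units_x4)
qed

text \<open>With \<open>UNIV\<close> this is the ring of fractions whose denominators are units
  modulo the ideal; with \<open>vortex_ideal\<close> it is the extension of the ideal to that
  ring.\<close>

definition localized :: "mpol set \<Rightarrow> ratfun set" where
  "localized I = {Fract a b | a b. a \<in> I \<and> b \<in> ideal_units}"

abbreviation local_ring :: "ratfun set" where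
  "local_ring \<equiv> localized UNIV"

abbreviation local_ideal :: "ratfun set" where
  "local_ideal \<equiv> localized vortex_ideal"

lemma localizedI: "a \<in> I \<Longrightarrow> b \<in> ideal_units \<Longrightarrow> Fract a b \<in> localized I"
  unfolding localized_def by blast

lemma localizedE:
  assumes "f \<in> localized I"
  obtains a b where "f = Fract a b" "a \<in> I" "b \<in> ideal_units" "b \<noteq> 0"
  using assms ideal_units_nonzero unfolding localized_def by blast

lemma local_ring_poly: "Fract p 1 \<in> local_ring"
  by (simp add: localizedI ideal_units_1)

lemma local_ring_of_rat: "of_rat a \<in> local_ring"
  using local_ring_poly by (simp flip: Fract_const)

lemma local_ring_rvar: "rvar v \<in> local_ring"
  by (simp add: rvar_def local_ring_poly)

lemma local_ring_add: "f \<in> local_ring \<Longrightarrow> g \<in> local_ring \<Longrightarrow> f + g \<in> local_ring"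
  by (elim localizedE) (simp add: localizedI ideal_units_mult)

lemma local_ring_mult: "f \<in> local_ring \<Longrightarrow> g \<in> local_ring \<Longrightarrow> f * g \<in> local_ring"
  by (elim localizedE) (simp add: localizedI ideal_units_mult)

lemma local_ring_1: "1 \<in> local_ring"
  using local_ring_of_rat[of 1] by simp

lemma local_ring_numeral: "numeral n \<in> local_ring"
  using local_ring_of_rat[of "numeral n"] by simp

lemma local_ring_minus: "f \<in> local_ring \<Longrightarrow> - f \<in> local_ring"
  using local_ring_mult[OF local_ring_of_rat[of "-1"], of f] by simp

lemma local_ring_diff: "f \<in> local_ring \<Longrightarrow> g \<in> local_ring \<Longrightarrow> f - g \<in> local_ring"
  using local_ring_add[OF _ local_ring_minus, of f g] by simp

lemma local_ring_power: "f \<in> local_ring \<Longrightarrow> f ^ n \<in> local_ring"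
  by (induction n) (simp_all add: local_ring_1 local_ring_mult)

lemma local_ring_divide: "f \<in> local_ring \<Longrightarrow> inverse g \<in> local_ring \<Longrightarrow> f / g \<in> local_ring"
  by (simp add: divide_inverse local_ring_mult)

lemma local_ideal_add: "f \<in> local_ideal \<Longrightarrow> g \<in> local_ideal \<Longrightarrow> f + g \<in> local_ideal"
  by (elim localizedE)
    (simp add: localizedI ideal_units_mult vortex_ideal_add vortex_ideal_mult_right)

lemma local_ideal_mult: "f \<in> local_ring \<Longrightarrow> g \<in> local_ideal \<Longrightarrow> f * g \<in> local_ideal"
  by (elim localizedE) (simp add: localizedI ideal_units_mult vortex_ideal_mult)

lemma local_ideal_0: "0 \<in> local_ideal"
  unfolding Zero_fract_def by (rule localizedI[OF vortex_ideal_0 ideal_units_1])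

text \<open>Cross-multiplication puts \<open>N * b\<close> into the ideal, and an inverse of
  \<open>b\<close> modulo the ideal removes \<open>b\<close>. Only \<open>b\<close> has to be a
  unit, so \<open>D\<close> may be any nonzero denominator.\<close>

lemma local_ideal_contraction:
  assumes "D \<noteq> 0" "Fract N D \<in> local_ideal"
  shows "N \<in> vortex_ideal"
proof -
  obtain a b where ab: "Fract N D = Fract a b" "a \<in> vortex_ideal" "b \<in> ideal_units" "b \<noteq> 0"
    using assms(2) by (rule localizedE)
  then have "N * b = a * D" using assms(1) by (simp add: eq_fract)
  then have Nb: "N * b \<in> vortex_ideal" using ab(2) by (simp add: vortex_ideal_mult_right)
  obtain c where c: "b * c - 1 \<in> vortex_ideal" using ab(3) by (auto simp: ideal_units_def)
  have "N = N * b * c - N * (b * c - 1)" by (simp add: algebra_simps)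
  also have "\<dots> \<in> vortex_ideal"
    by (intro vortex_ideal_diff vortex_ideal_mult_right[OF Nb] vortex_ideal_mult[OF c])
  finally show ?thesis .
qed

lemma peval_local_ring:
  assumes "\<And>v. \<sigma> v \<in> local_ring"
  shows "peval \<sigma> p \<in> local_ring"
proof (induction p rule: poly_mapping_add_induct)
  case zero
  show ?case using local_ring_of_rat[of 0] by simp
next
  case (single k a)
  have "(\<Prod>v\<in>V. \<sigma> v ^ n v) \<in> local_ring" for V n
    by (induction V rule: infinite_finite_induct)
      (simp_all add: assms local_ring_1 local_ring_mult local_ring_power)
  then have "mono_eval \<sigma> k \<in> local_ring"
    unfolding mono_eval_def .
  then show ?case by (simp add: peval_single local_ring_mult local_ring_of_rat)
qed (simp add: peval_add local_ring_add)

text \<open>Substitution is a ring homomorphism into \<open>local_ring\<close>, so it suffices to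
  check the generators.\<close>

lemma peval_local_ideal:
  assumes "\<And>v. \<sigma> v \<in> local_ring"
    and "\<And>f. f \<in> {f1, f2, f3, f4, f5, f6} \<Longrightarrow> peval \<sigma> f \<in> local_ideal"
    and "p \<in> vortex_ideal"
  shows "peval \<sigma> p \<in> local_ideal"
  using assms(3)[unfolded vortex_ideal_def]
proof (induction rule: module.span_induct_alt[OF module_mpol, consumes 1, case_names base step])
  case (step c x y)
  with assms(2) show ?case
    by (simp only: peval_hom) (intro local_ideal_add local_ideal_mult peval_local_ring assms(1))
qed (simp add: local_ideal_0)

text \<open>The factors are the common denominators of the four equations.\<close>

lemma peval_generators:
  fixes \<sigma> :: "pvar \<Rightarrow> 'a::field_char_0"
  defines "P \<equiv> (\<sigma> V_x3, \<sigma> V_x4)"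
  defines "E \<equiv> equilibrium (\<sigma> V_m) (\<sigma> V_omega) (\<sigma> V_c) (config P)"
  assumes "inj_on (config P) {1..4}"
  shows "peval \<sigma> f1 = 2 * (\<sigma> V_x3 + 1) * (\<sigma> V_x4 + 1) * E 1"
    and "peval \<sigma> f2 = 2 * (\<sigma> V_x3 - 1) * (\<sigma> V_x4 - 1) * E 2"
    and "peval \<sigma> f3 = (\<sigma> V_x3 + 1) * (\<sigma> V_x3 - 1) * (\<sigma> V_x4 - \<sigma> V_x3) * E 3"
    and "peval \<sigma> f4 = (\<sigma> V_x4 + 1) * (\<sigma> V_x4 - 1) * (\<sigma> V_x4 - \<sigma> V_x3) * E 4"
proof -
  have P: "fst P = \<sigma> V_x3" "snd P = \<sigma> V_x4" by (simp_all add: P_def)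
  \<comment> \<open>Named denominators stay atomic when the fractions are cleared.\<close>
  define a where "a = \<sigma> V_x3 + 1"
  define b where "b = \<sigma> V_x3 - 1"
  define c where "c = \<sigma> V_x4 + 1"
  define d where "d = \<sigma> V_x4 - 1"
  define e where "e = \<sigma> V_x4 - \<sigma> V_x3"
  note abbr = a_def b_def c_def d_def e_def
  have nz: "a \<noteq> 0" "b \<noteq> 0" "c \<noteq> 0" "d \<noteq> 0" "e \<noteq> 0"
    using assms(3) unfolding inj_on_config_4 P abbr by (auto simp: add_eq_0_iff2)
  have E: "E 1 = \<sigma> V_omega * (-1 - \<sigma> V_c) + 1 / 2 + 1 / a + \<sigma> V_m / c"
    "E 2 = \<sigma> V_omega * (1 - \<sigma> V_c) - 1 / 2 + 1 / b + \<sigma> V_m / d"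
    "E 3 = \<sigma> V_omega * (\<sigma> V_x3 - \<sigma> V_c) - 1 / a - 1 / b + \<sigma> V_m / e"
    "E 4 = \<sigma> V_omega * (\<sigma> V_x4 - \<sigma> V_c) - 1 / c - 1 / d - 1 / e"
  proof -
    have minus: "-1 - x = - (x + 1)" "1 - x = - (x - 1)" "\<sigma> V_x3 - \<sigma> V_x4 = - (\<sigma> V_x4 - \<sigma> V_x3)" for x :: 'a
      by simp_all
    show "E 1 = \<sigma> V_omega * (-1 - \<sigma> V_c) + 1 / 2 + 1 / a + \<sigma> V_m / c"
      "E 2 = \<sigma> V_omega * (1 - \<sigma> V_c) - 1 / 2 + 1 / b + \<sigma> V_m / d"
      unfolding E_def abbr equilibrium_expand config_simps P by simp_all
    show "E 3 = \<sigma> V_omega * (\<sigma> V_x3 - \<sigma> V_c) - 1 / a - 1 / b + \<sigma> V_m / e"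
      "E 4 = \<sigma> V_omega * (\<sigma> V_x4 - \<sigma> V_c) - 1 / c - 1 / d - 1 / e"
      unfolding E_def abbr equilibrium_expand config_simps P minus(1)[of "\<sigma> V_x3"]
        minus(1)[of "\<sigma> V_x4"] minus(2)[of "\<sigma> V_x3"] minus(2)[of "\<sigma> V_x4"] minus(3)
      by (simp_all only: divide_minus_right diff_conv_add_uminus)
  qed
  show "peval \<sigma> f1 = 2 * (\<sigma> V_x3 + 1) * (\<sigma> V_x4 + 1) * E 1"
    unfolding E f1_def peval_hom peval_Var peval_1 peval_numeral abbr[symmetric]
    using nz by (simp add: field_simps)
  show "peval \<sigma> f2 = 2 * (\<sigma> V_x3 - 1) * (\<sigma> V_x4 - 1) * E 2"
    unfolding E f2_def peval_hom peval_Var peval_1 peval_numeral abbr[symmetric]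
    using nz by (simp add: field_simps)
  show "peval \<sigma> f3 = (\<sigma> V_x3 + 1) * (\<sigma> V_x3 - 1) * (\<sigma> V_x4 - \<sigma> V_x3) * E 3"
    unfolding E f3_def peval_hom peval_Var peval_1 peval_numeral abbr[symmetric]
    using nz by (simp add: field_simps)
  show "peval \<sigma> f4 = (\<sigma> V_x4 + 1) * (\<sigma> V_x4 - 1) * (\<sigma> V_x4 - \<sigma> V_x3) * E 4"
    unfolding E f4_def peval_hom peval_Var peval_1 peval_numeral abbr[symmetric]
    using nz by (simp add: field_simps)
qed

text \<open>This pair is both the identity map and the generic point of the plane; applying
  \<open>relabel\<close> to it yields a rational map.\<close>

abbreviation plane :: ratmap where
  "plane \<equiv> (rvar V_x3, rvar V_x4)"

lemma
  shows rdefined_config: "rdefined \<sigma> (config plane i)"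
    and reval_config: "reval \<sigma> (config plane i) = config (\<sigma> V_x3, \<sigma> V_x4) i"
  by (simp_all add: config_def rdefined_minus reval_minus)

text \<open>Equal rational functions would have equal values at (2, 3), where the four positions are
  -1, 1, 2, 3.\<close>

lemma inj_on_config_plane: "inj_on (config plane) {1..4}"
proof (rule inj_onI)
  fix i j :: nat assume ij: "i \<in> {1..4}" "j \<in> {1..4}" "config plane i = config plane j"
  let ?P = "(2, 3) :: real \<times> real"
  have "config ?P k = reval (point_subst ?P) (config plane k)" for k
    by (simp add: reval_config point_subst_def)
  then have "config ?P i = config ?P j" using ij(3) by simp
  moreover have "inj_on (config ?P) {1..4}" unfolding inj_on_config_4 by simp
  ultimately show "i = j" using ij(1,2) by (meson inj_onD)
qed

lemma local_ring_config: "config plane i \<in> local_ring"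
  by (simp add: config_def local_ring_1 local_ring_minus local_ring_rvar)

lemma local_ring_inverse_mult:
  "inverse f \<in> local_ring \<Longrightarrow> inverse g \<in> local_ring \<Longrightarrow> inverse (f * g) \<in> local_ring"
  by (simp add: local_ring_mult)

lemma local_ring_inverse_peval: "b \<in> ideal_units \<Longrightarrow> inverse (peval rvar b) \<in> local_ring"
  by (simp add: peval_rvar localizedI)

lemmas local_ring_inverses =
  local_ring_inverse_peval[OF ideal_units_2]
  ideal_units_x4[THEN local_ring_inverse_peval]
  ideal_units_x3[THEN local_ring_inverse_peval]

text \<open>Up to sign there are six differences, and each is among the units found in
  \<open>ideal_units_2\<close>, \<open>ideal_units_x4\<close> and
  \<open>ideal_units_x3\<close>.\<close>

lemma local_ring_inverse_config:
  assumes "i \<in> {1..4}" "j \<in> {1..4}" "i \<noteq> j"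
  shows "inverse (config plane i - config plane j) \<in> local_ring"
proof -
  have less: "inverse (config plane l - config plane k) \<in> local_ring"
    if "k \<in> {1..4}" "l \<in> {1..4}" "k < l" for k l
  proof -
    have "(k, l) \<in> {(1, 2), (1, 3), (1, 4), (2, 3), (2, 4), (3, 4)}" using that by auto
    then show ?thesis
      using local_ring_inverses by (auto simp: peval_hom)
  qed
  show ?thesis
  proof (cases "j < i")
    case False
    with assms have "inverse (config plane j - config plane i) \<in> local_ring" by (intro less) auto
    then have "inverse (- (config plane j - config plane i)) \<in> local_ring"
      unfolding inverse_minus_eq by (rule local_ring_minus)
    then show ?thesis by simp
  qed (use assms less in auto)
qed

text \<open>Each of \<open>f1\<close> to \<open>f4\<close> is a common denominator times one
  equation, and that denominator is invertible in \<open>local_ring\<close>.\<close>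

lemma equilibrium_local_ideal:
  assumes "i \<in> {1..4}"
  shows "equilibrium (rvar V_m) (rvar V_omega) (rvar V_c) (config plane) i \<in> local_ideal"
proof -
  have inv: "inverse (2 :: ratfun) \<in> local_ring"
    "inverse (rvar V_x3 + 1) \<in> local_ring" "inverse (rvar V_x3 - 1) \<in> local_ring"
    "inverse (rvar V_x4 + 1) \<in> local_ring" "inverse (rvar V_x4 - 1) \<in> local_ring"
    "inverse (rvar V_x4 - rvar V_x3) \<in> local_ring"
    using local_ring_inverses by (simp_all add: peval_hom)
  have nz: "rvar V_x3 + 1 \<noteq> 0" "rvar V_x3 - 1 \<noteq> 0" "rvar V_x4 + 1 \<noteq> 0" "rvar V_x4 - 1 \<noteq> 0"
    "rvar V_x4 - rvar V_x3 \<noteq> 0"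
    using inj_on_config_plane unfolding inj_on_config_4 by (auto simp: add_eq_0_iff2)
  have divide: "e \<in> local_ideal"
    if "f \<in> {f1, f2, f3, f4}" "peval rvar f = d * e" "inverse d \<in> local_ring" "d \<noteq> 0" for f d e
  proof -
    have "peval rvar f \<in> local_ideal"
      unfolding peval_rvar using that(1)
      by (intro localizedI ideal_units_1 generators_in_vortex_ideal) auto
    then have "inverse d * peval rvar f \<in> local_ideal" by (rule local_ideal_mult[OF that(3)])
    moreover have "inverse d * peval rvar f = e"
      unfolding that(2) mult.assoc[symmetric] using that(4) by simp
    ultimately show ?thesis by simp
  qed
  note gen = peval_generators[of rvar, OF inj_on_config_plane]
  let ?E = "equilibrium (rvar V_m) (rvar V_omega) (rvar V_c) (config plane)"
  have "?E 1 \<in> local_ideal"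
    by (rule divide[OF _ gen(1)], simp, intro local_ring_inverse_mult inv,
      intro no_zero_divisors nz zero_neq_numeral[symmetric])
  moreover have "?E 2 \<in> local_ideal"
    by (rule divide[OF _ gen(2)], simp, intro local_ring_inverse_mult inv,
      intro no_zero_divisors nz zero_neq_numeral[symmetric])
  moreover have "?E 3 \<in> local_ideal"
    by (rule divide[OF _ gen(3)], simp, intro local_ring_inverse_mult inv,
      intro no_zero_divisors nz zero_neq_numeral[symmetric])
  moreover have "?E 4 \<in> local_ideal"
    by (rule divide[OF _ gen(4)], simp, intro local_ring_inverse_mult inv,
      intro no_zero_divisors nz zero_neq_numeral[symmetric])
  ultimately show ?thesis using assms unfolding nat_interval_4 by blast
qed

lemma relabel_invariant:
  assumes p: "p permutes {1..3}"
  shows "invariant_under elim_ideal (relabel p plane)"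
proof -
  define z where "z = config plane \<circ> p"
  define g where "g = relabel p plane"
  \<comment> \<open>The map is extended to the other variables: \<open>V_omega\<close> and
    \<open>V_c\<close> change as in \<open>equilibrium_renormalize\<close>, \<open>V_u\<close> and
    \<open>V_v\<close> become the inverses that make \<open>f5\<close> and \<open>f6\<close> vanish,
    and \<open>V_m\<close> is fixed.\<close>
  define \<sigma> where "\<sigma> v = (case v of
      V_omega \<Rightarrow> rvar V_omega * ((z 2 - z 1) / 2)\<^sup>2 | V_c \<Rightarrow> (2 * rvar V_c - z 1 - z 2) / (z 2 - z 1)
    | V_u \<Rightarrow> 1 / (snd g - 1) | V_v \<Rightarrow> 1 / (snd g + 1)
    | V_x3 \<Rightarrow> fst g | V_x4 \<Rightarrow> snd g | V_m \<Rightarrow> rvar V_m)" for v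
  have p4: "p permutes {1..4}" by (rule permutes_subset[OF p]) auto
  note inj3 = inj_on_config_subset[OF inj_on_config_plane]
  have config_g: "config g = renormalize z"
    using config_relabel[OF inj3 p] by (simp add: g_def z_def)
  have inj_g: "inj_on (config g) {1..4}"
    unfolding g_def by (rule inj_on_relabel[OF inj_on_config_plane inj3 p p4])
  have z: "z i \<in> local_ring" for i
    by (simp add: z_def local_ring_config)
  have inv_z: "inverse (z i - z j) \<in> local_ring" if "i \<in> {1..4}" "j \<in> {1..4}" "i \<noteq> j" for i j
  proof -
    have "p i \<noteq> p j" using that(3) permutes_inj[OF p] by (simp add: inj_eq)
    moreover have "p i \<in> {1..4}" "p j \<in> {1..4}"
      using that(1,2) by (simp_all only: permutes_in_image[OF p4])
    ultimately show ?thesis unfolding z_def o_def by (rule local_ring_inverse_config[rotated 2])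
  qed
  have inv2: "inverse 2 \<in> local_ring" using local_ring_inverses(1) by simp
  have norm: "renormalize z i \<in> local_ring" for i
  proof -
    have "inverse (z 2 - z 1) \<in> local_ring" by (rule inv_z) simp_all
    moreover have "2 * z i - z 1 - z 2 \<in> local_ring"
      by (intro local_ring_diff local_ring_mult local_ring_numeral z)
    ultimately show ?thesis unfolding renormalize_def by (rule local_ring_divide[rotated])
  qed
  \<comment> \<open>Renormalized differences are the original ones up to an invertible factor. The
    pairs 4, 2 and 4, 1 put the images of \<open>V_u\<close> and \<open>V_v\<close> into
    \<open>local_ring\<close>.\<close>
  have inv_norm: "inverse (renormalize z i - renormalize z j) \<in> local_ring"
    if "i \<in> {1..4}" "j \<in> {1..4}" "i \<noteq> j" for i j
  proof -
    have "inverse (renormalize z i - renormalize z j) = (z 2 - z 1) * (inverse 2 * inverse (z i - z j))"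
      unfolding renormalize_diff divide_inverse inverse_mult_distrib inverse_inverse_eq
      by (rule mult.commute)
    also have "\<dots> \<in> local_ring"
      by (intro local_ring_mult local_ring_diff z inv2 inv_z that)
    finally show ?thesis .
  qed
  have g: "fst g = renormalize z 3" "snd g = renormalize z 4"
    "renormalize z 1 = -1" "renormalize z 2 = 1"
    by (simp_all add: config_simps flip: config_g del: One_nat_def)
  have "inverse (snd g - 1) \<in> local_ring" "inverse (snd g + 1) \<in> local_ring"
    using inv_norm[of 4 2] inv_norm[of 4 1] g by simp_all
  then have "1 / (snd g - 1) \<in> local_ring" "1 / (snd g + 1) \<in> local_ring"
    by (simp_all only: divide_inverse mult_1)
  moreover have "inverse (z 2 - z 1) \<in> local_ring" by (rule inv_z) simp_all
  then have "(2 * rvar V_c - z 1 - z 2) / (z 2 - z 1) \<in> local_ring"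
    by (intro local_ring_divide local_ring_diff local_ring_mult local_ring_numeral local_ring_rvar z)
  moreover have half: "(z 2 - z 1) / 2 \<in> local_ring"
    by (intro local_ring_divide local_ring_diff z inv2)
  then have "rvar V_omega * ((z 2 - z 1) / 2)\<^sup>2 \<in> local_ring"
    by (intro local_ring_mult local_ring_power local_ring_rvar)
  moreover have "fst g \<in> local_ring" "snd g \<in> local_ring"
    unfolding g by (rule norm)+
  ultimately have \<sigma>: "\<sigma> v \<in> local_ring" for v
    unfolding \<sigma>_def by (cases v) (simp_all only: pvar.case local_ring_rvar)
  have "z 1 \<noteq> z 2"
    using inj_on_permuted[OF inj3 p, of 1 2] by (simp add: z_def)
  note renorm = equilibrium_renormalize[OF this, of "rvar V_m" "rvar V_omega" "rvar V_c"]
  have E: "equilibrium (\<sigma> V_m) (\<sigma> V_omega) (\<sigma> V_c) (config (\<sigma> V_x3, \<sigma> V_x4)) i \<in> local_ideal"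
    if "i \<in> {1..4}" for i
  proof -
    have "equilibrium (\<sigma> V_m) (\<sigma> V_omega) (\<sigma> V_c) (config (\<sigma> V_x3, \<sigma> V_x4)) i =
        (z 2 - z 1) / 2 * equilibrium (rvar V_m) (rvar V_omega) (rvar V_c) (config plane) (p i)"
    proof -
      have "config (\<sigma> V_x3, \<sigma> V_x4) = renormalize z" "\<sigma> V_m = rvar V_m"
        "\<sigma> V_omega = rvar V_omega * ((z 2 - z 1) / 2)\<^sup>2"
        "\<sigma> V_c = (2 * rvar V_c - z 1 - z 2) / (z 2 - z 1)"
        by (simp_all add: \<sigma>_def config_g)
      then show ?thesis
        by (simp only: renorm) (simp only: z_def equilibrium_permuted[OF p that])
    qed
    also have "\<dots> \<in> local_ideal"
    proof (intro local_ideal_mult half equilibrium_local_ideal)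
      show "p i \<in> {1..4}" using that by (simp only: permutes_in_image[OF p4])
    qed
    finally show ?thesis .
  qed
  have \<sigma>g: "(\<sigma> V_x3, \<sigma> V_x4) = g" by (simp add: \<sigma>_def)
  note gens = peval_generators[of \<sigma>, unfolded \<sigma>g, OF inj_g, folded \<sigma>g]
  have nz: "snd g - 1 \<noteq> 0" "snd g + 1 \<noteq> 0"
    using inj_g unfolding inj_on_config_4 by (auto simp: add_eq_0_iff2)
  have gen: "peval \<sigma> f \<in> local_ideal" if "f \<in> {f1, f2, f3, f4, f5, f6}" for f
  proof -
    have "peval \<sigma> f5 = 0" "peval \<sigma> f6 = 0"
      using nz by (simp_all add: f5_def f6_def peval_hom \<sigma>_def)
    moreover have "peval \<sigma> f1 \<in> local_ideal" "peval \<sigma> f2 \<in> local_ideal"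
      "peval \<sigma> f3 \<in> local_ideal" "peval \<sigma> f4 \<in> local_ideal"
      unfolding gens
      by (intro local_ideal_mult E local_ring_mult local_ring_add local_ring_diff local_ring_numeral
          local_ring_1 \<sigma>; simp)+
    ultimately show ?thesis using that local_ideal_0 by auto
  qed
  have main: "peval \<sigma> q \<in> local_ideal" if "q \<in> vortex_ideal" for q
    by (rule peval_local_ideal[OF \<sigma> gen that])
  show ?thesis
    unfolding invariant_under_def
  proof (intro ballI impI)
    fix q N D :: mpol
    assume q: "q \<in> elim_ideal" and N: "N \<in> polys_in {V_x3, V_x4, V_m}" and D: "D \<noteq> 0"
      and eq: "peval (map_subst (relabel p plane)) q = Fract N D"
    \<comment> \<open>Elements of \<open>elim_ideal\<close> contain only the variables on which
      \<open>\<sigma>\<close> agrees with the map itself.\<close>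
    have "peval (map_subst g) q = peval \<sigma> q"
      by (rule peval_cong[of q "{V_x3, V_x4, V_m}"])
        (use q in \<open>auto simp: elim_ideal_def \<sigma>_def map_subst_other\<close>)
    with eq have "Fract N D = peval \<sigma> q" by (simp only: g_def)
    also have "\<dots> \<in> local_ideal" using q by (intro main) (simp add: elim_ideal_def)
    finally have "N \<in> vortex_ideal" by (rule local_ideal_contraction[OF D])
    with N show "N \<in> elim_ideal" by (simp add: elim_ideal_def)
  qed
qed

section \<open>The group of relabellings\<close>

lemma inj_on_config_plane_3: "inj_on (config plane) {1..3}"
  by (rule inj_on_config_subset[OF inj_on_config_plane])

section \<open>Evaluation and composition of relabellings\<close>

lemma reval_2: "rdefined \<sigma> 2" "reval \<sigma> 2 = 2"
proof -
  have "2 = Fract (2 :: mpol) 1" using peval_rvar[of 2] by simp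
  then show "rdefined \<sigma> 2" "reval \<sigma> 2 = 2"
    using rdefined_poly[of \<sigma> 2] reval_poly[of \<sigma> 2] by (simp_all only: peval_numeral)
qed

text \<open>Relabelling uses only field operations, and its denominator does not vanish where the
  first three points are distinct. The target field is arbitrary, so this covers real points and
  composition with another rational map.\<close>

lemma
  fixes \<sigma> :: "pvar \<Rightarrow> 'a::field_char_0"
  defines "P \<equiv> (\<sigma> V_x3, \<sigma> V_x4)"
  assumes "inj_on (config P) {1..3}" "p permutes {1..3}"
  shows rdefined_relabel: "rdefined \<sigma> (fst (relabel p plane))" "rdefined \<sigma> (snd (relabel p plane))"
    and reval_relabel: "(reval \<sigma> (fst (relabel p plane)), reval \<sigma> (snd (relabel p plane))) = relabel p P"
proof -
  have P: "rdefined \<sigma> (config plane i)" "reval \<sigma> (config plane i) = config P i" for i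
    by (simp_all add: rdefined_config reval_config P_def)
  have nz: "config P (p 2) - config P (p 1) \<noteq> 0"
    using inj_on_permuted[OF assms(2,3), of 1 2] by simp
  let ?num = "\<lambda>i. 2 * config plane (p i) - config plane (p 1) - config plane (p 2)"
  have num: "rdefined \<sigma> (?num i)"
      "reval \<sigma> (?num i) = 2 * config P (p i) - config P (p 1) - config P (p 2)" for i
    by (simp_all add: rdefined_diff rdefined_mult reval_diff reval_mult P reval_2)
  have den: "rdefined \<sigma> (config plane (p 2) - config plane (p 1))"
      "reval \<sigma> (config plane (p 2) - config plane (p 1)) = config P (p 2) - config P (p 1)"
    by (simp_all add: rdefined_diff reval_diff P)
  have "rdefined \<sigma> (renormalize (config plane \<circ> p) i)"
    "reval \<sigma> (renormalize (config plane \<circ> p) i) = renormalize (config P \<circ> p) i" for i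
    unfolding renormalize_def o_apply
    using rdefined_divide[OF num(1) den(1)] reval_divide[OF num(1) den(1)] nz
    by (simp_all only: num den not_False_eq_True)
  then show "rdefined \<sigma> (fst (relabel p plane))" "rdefined \<sigma> (snd (relabel p plane))"
    "(reval \<sigma> (fst (relabel p plane)), reval \<sigma> (snd (relabel p plane))) = relabel p P"
    by (simp_all add: relabel_def)
qed

lemma
  assumes "inj_on (config P) {1..3}" "p permutes {1..3}"
  shows map_defined_at_relabel: "map_defined_at (relabel p plane) P"
    and map_at_relabel: "map_at (relabel p plane) P = relabel p P"
proof -
  have "(point_subst P V_x3, point_subst P V_x4) = P" by (simp add: point_subst_def)
  then show "map_defined_at (relabel p plane) P" "map_at (relabel p plane) P = relabel p P"
    using rdefined_relabel[of "point_subst P"] reval_relabel[of "point_subst P"] assms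
    by (simp_all only: map_defined_at_def map_at_def)
qed

text \<open>Composition evaluates the first map at the point \<open>relabel q plane\<close>, so this
  is an instance of \<open>reval_relabel\<close>, followed by the right action law.\<close>

lemma
  assumes "p permutes {1..3}" "q permutes {1..3}"
  shows relabel_comp: "ratmap_comp (relabel p plane) (relabel q plane) = relabel (q \<circ> p) plane"
    and rdefined_relabel_subst: "rdefined (map_subst (relabel q plane)) (map_subst (relabel p plane) v)"
proof -
  let ?h = "relabel q plane"
  have h: "(map_subst ?h V_x3, map_subst ?h V_x4) = ?h" by simp
  have inj: "inj_on (config ?h) {1..3}"
    by (rule inj_on_relabel[OF inj_on_config_plane_3 inj_on_config_plane_3 assms(2,2)])
  have "ratmap_comp (relabel p plane) ?h = relabel p ?h"
    unfolding ratmap_comp_def using reval_relabel[of "map_subst ?h", unfolded h, OF inj assms(1)] .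
  then show "ratmap_comp (relabel p plane) ?h = relabel (q \<circ> p) plane"
    by (simp only: relabel_relabel[OF inj_on_config_plane_3 assms(2,1)])
  show "rdefined (map_subst ?h) (map_subst (relabel p plane) v)"
    using rdefined_relabel[of "map_subst ?h", unfolded h, OF inj assms(1)]
    by (simp add: map_subst_def[of "relabel p plane"])
qed

lemma relabel_dominant:
  assumes p: "p permutes {1..3}"
  shows "dominant (relabel p plane)"
  unfolding dominant_def
proof (intro conjI ballI impI)
  have 1: "1 \<in> ratfuns_in W" and 2: "2 \<in> ratfuns_in W" for W
    using ratfuns_in_const[of 1] ratfuns_in_const[of 2] by simp_all
  have "config plane i \<in> ratfuns_in {V_x3, V_x4}" for i
    by (simp add: config_def 1 ratfuns_in_minus ratfuns_in_rvar)
  then have "renormalize (config plane \<circ> p) i \<in> ratfuns_in {V_x3, V_x4}" for i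
    unfolding renormalize_def by (simp add: 2 ratfuns_in_divide ratfuns_in_diff ratfuns_in_mult)
  then show "fst (relabel p plane) \<in> ratfuns_in {V_x3, V_x4}" "snd (relabel p plane) \<in> ratfuns_in {V_x3, V_x4}"
    by (simp_all add: relabel_def)
next
  fix f :: mpol assume "f \<noteq> 0"
  let ?q = "inv' p"
  have q: "?q permutes {1..3}" by (rule permutes_inv[OF p])
  \<comment> \<open>Substituting the relabelling by \<open>inv' p\<close> recovers \<open>f\<close>,
    so the value of \<open>f\<close> under the first substitution cannot be 0.\<close>
  have "reval (map_subst (relabel ?q plane)) (peval (map_subst (relabel p plane)) f) =
      peval (map_subst (relabel (?q \<circ> p) plane)) f"
    using rdefined_relabel_subst[OF p q] by (simp add: reval_peval reval_map_subst relabel_comp[OF p q])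
  also have "\<dots> = Fract f 1"
    by (simp add: permutes_inv_o[OF p] relabel_id map_subst_one peval_rvar)
  finally show "peval (map_subst (relabel p plane)) f \<noteq> 0"
    using \<open>f \<noteq> 0\<close> by (auto simp: Zero_fract_def eq_fract)
qed

section \<open>Relabellings inside the birational group\<close>

lemma birational_group: "group birational_group"
  unfolding birational_group_def by (rule monoid.units_group[OF ratmap_monoid])

lemma birational_group_mult: "g \<otimes>\<^bsub>birational_group\<^esub> h = ratmap_comp g h"
  by (simp add: birational_group_def units_of_mult ratmap_monoid_def)

lemma birational_group_one: "\<one>\<^bsub>birational_group\<^esub> = plane"
  by (simp add: birational_group_def units_of_one ratmap_monoid_def)

lemma relabel_birational:
  assumes p: "p permutes {1..3}"
  shows "relabel p plane \<in> carrier birational_group"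
proof -
  let ?q = "inv' p"
  have q: "?q permutes {1..3}" by (rule permutes_inv[OF p])
  have "ratmap_comp (relabel ?q plane) (relabel p plane) = plane"
    "ratmap_comp (relabel p plane) (relabel ?q plane) = plane"
    by (simp_all add: relabel_comp[OF p q] relabel_comp[OF q p] permutes_inv_o[OF p] relabel_id)
  then show ?thesis
    using relabel_dominant[OF p] relabel_dominant[OF q]
    unfolding birational_group_def units_of_carrier Units_def ratmap_monoid_def
    by (simp del: split_paired_Ex) blast
qed

lemma relabel_inv:
  assumes p: "p permutes {1..3}"
  shows "inv\<^bsub>birational_group\<^esub> (relabel p plane) = relabel (inv' p) plane"
  using group.inv_equality[OF birational_group, of "relabel (inv' p) plane" "relabel p plane"]
    relabel_birational p permutes_inv[OF p]
  by (simp add: birational_group_mult birational_group_one relabel_comp permutes_inv_o[OF p] relabel_id)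

text \<open>The relabellings inducing \<open>R\<close> and \<open>S\<close>: \<open>S\<close> takes \<open>1, x\<^sub>3, -1\<close> to \<open>-1, 1, x\<^sub>3'\<close>.\<close>

definition perm_R :: "nat \<Rightarrow> nat" where "perm_R = transpose 1 2"
definition perm_S :: "nat \<Rightarrow> nat" where "perm_S = transpose 1 2 \<circ> transpose 2 3"

lemma perm_R_values: "perm_R 1 = 2" "perm_R 2 = 1" "perm_R 3 = 3" "perm_R 4 = 4"
  by (simp_all add: perm_R_def transpose_def)

lemma perm_S_values: "perm_S 1 = 2" "perm_S 2 = 3" "perm_S 3 = 1" "perm_S 4 = 4"
  by (simp_all add: perm_S_def transpose_def)

lemma perm_R_permutes: "perm_R permutes {1..3}"
  unfolding perm_R_def by (rule permutes_swap_id) auto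

lemma perm_S_permutes: "perm_S permutes {1..3}"
  unfolding perm_S_def by (intro permutes_compose permutes_swap_id) auto

lemma map_R_relabel: "map_R = relabel perm_R plane"
  unfolding map_R_def relabel_def renormalize_def o_apply perm_R_values config_simps
  by (simp add: minus_divide_left)

lemma map_S_relabel: "map_S = relabel perm_S plane"
proof -
  have "rvar V_x3 \<noteq> 1" using inj_on_config_plane unfolding inj_on_config_4 by auto
  then have "1 - rvar V_x3 \<noteq> 0" "rvar V_x3 - 1 \<noteq> 0" by simp_all
  then show ?thesis
    unfolding map_S_def relabel_def renormalize_def o_apply perm_S_values config_simps
    by (simp add: frac_eq_eq algebra_simps)
qed

text \<open>Writing all six permutations as words in the two generators shows that
  \<open>map_R\<close> and \<open>map_S\<close> generate every relabelling.\<close>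

lemma permutes_3_cases:
  assumes p: "p permutes {1..3}"
  shows "p \<in> {id, perm_R, perm_S, perm_S \<circ> perm_S, perm_R \<circ> perm_S, perm_S \<circ> perm_R}"
proof -
  have eqI: "p = q" if "q permutes {1..3}" "p 1 = q 1" "p 2 = q 2" "p 3 = q 3" for q
  proof
    fix i
    show "p i = q i"
    proof (cases "i \<in> {1..3}")
      case True
      then show ?thesis using that(2-4) unfolding nat_interval_3 by blast
    next
      case False
      then show ?thesis using p that(1) by (simp add: permutes_def)
    qed
  qed
  have "p 1 \<in> {1, 2, 3}" "p 2 \<in> {1, 2, 3}" "p 3 \<in> {1, 2, 3}"
    using permutes_in_image[OF p] unfolding nat_interval_3 by auto
  moreover have "p 1 \<noteq> p 2" "p 1 \<noteq> p 3" "p 2 \<noteq> p 3"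
    using permutes_inj[OF p] by (simp_all add: inj_eq del: One_nat_def)
  ultimately consider
      "p 1 = 1" "p 2 = 2" "p 3 = 3" | "p 1 = 2" "p 2 = 1" "p 3 = 3" | "p 1 = 2" "p 2 = 3" "p 3 = 1"
    | "p 1 = 3" "p 2 = 1" "p 3 = 2" | "p 1 = 1" "p 2 = 3" "p 3 = 2" | "p 1 = 3" "p 2 = 2" "p 3 = 1"
    by (auto simp del: One_nat_def)
  then show ?thesis
  proof cases
    case 1
    then have "p = id" by (intro eqI) (simp_all add: permutes_id)
    then show ?thesis by simp
  next
    case 2
    then have "p = perm_R" by (intro eqI perm_R_permutes) (simp_all only: perm_R_values)
    then show ?thesis by simp
  next
    case 3
    then have "p = perm_S" by (intro eqI perm_S_permutes) (simp_all only: perm_S_values)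
    then show ?thesis by simp
  next
    case 4
    then have "p = perm_S \<circ> perm_S"
      by (intro eqI permutes_compose perm_S_permutes) (simp_all only: o_apply perm_S_values)
    then show ?thesis by simp
  next
    case 5
    then have "p = perm_R \<circ> perm_S"
      by (intro eqI permutes_compose perm_S_permutes perm_R_permutes)
        (simp_all only: o_apply perm_S_values perm_R_values)
    then show ?thesis by simp
  next
    case 6
    then have "p = perm_S \<circ> perm_R"
      by (intro eqI permutes_compose perm_S_permutes perm_R_permutes)
        (simp_all only: o_apply perm_S_values perm_R_values)
    then show ?thesis by simp
  qed
qed

text \<open>The relabellings contain both generators and are closed under products and inverses;
  conversely each is a word of length at most two.\<close>

lemma generate_RS:
  "generate birational_group {map_R, map_S} = (\<lambda>p. relabel p plane) ` {p. p permutes {1..3}}"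
proof (intro equalityI subsetI)
  fix g assume "g \<in> generate birational_group {map_R, map_S}"
  then show "g \<in> (\<lambda>p. relabel p plane) ` {p. p permutes {1..3}}"
  proof induction
    case one
    have "plane = relabel id plane" by (simp add: relabel_id)
    then show ?case unfolding birational_group_one using permutes_id by blast
  next
    case (incl h)
    then show ?case using perm_R_permutes perm_S_permutes map_R_relabel map_S_relabel by blast
  next
    case (inv h)
    then obtain p where "p permutes {1..3}" "h = relabel p plane"
      using perm_R_permutes perm_S_permutes map_R_relabel map_S_relabel by blast
    then show ?case using relabel_inv permutes_inv by blast
  next
    case (eng h1 h2)
    then obtain p q where pq: "p permutes {1..3}" "h1 = relabel p plane"
      "q permutes {1..3}" "h2 = relabel q plane" by blast
    then show ?case
      unfolding birational_group_mult using relabel_comp permutes_compose by blast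
  qed
next
  let ?G = "generate birational_group {map_R, map_S}"
  fix g assume "g \<in> (\<lambda>p. relabel p plane) ` {p. p permutes {1..3}}"
  then obtain p where p: "p permutes {1..3}" and g: "g = relabel p plane" by blast
  have one: "relabel id plane \<in> ?G"
    using generate.one[of birational_group "{map_R, map_S}"] by (simp add: birational_group_one relabel_id)
  have R: "relabel perm_R plane \<in> ?G" and S: "relabel perm_S plane \<in> ?G"
    unfolding map_R_relabel[symmetric] map_S_relabel[symmetric] by (auto intro: generate.incl)
  \<comment> \<open>The factors are exchanged in \<open>generate.eng\<close> because relabelling
    reverses composition.\<close>
  have comp: "relabel (q \<circ> r) plane \<in> ?G"
    if "relabel q plane \<in> ?G" "relabel r plane \<in> ?G" "q permutes {1..3}" "r permutes {1..3}" for q r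
    using generate.eng[OF that(2,1)] relabel_comp[OF that(4,3)] by (simp add: birational_group_mult)
  from permutes_3_cases[OF p] show "g \<in> ?G"
    unfolding g using one R S comp perm_R_permutes perm_S_permutes by auto
qed

text \<open>Evaluation at the real point (2, 3) reduces the claim to \<open>relabel_inj\<close>,
  which is stated over the reals.\<close>

lemma relabel_plane_inj: "inj_on (\<lambda>p. relabel p plane) {p. p permutes {1..3}}"
proof (rule inj_onI)
  fix p q assume pq: "p \<in> {p. p permutes {1..3}}" "q \<in> {p. p permutes {1..3}}"
    and eq: "relabel p plane = relabel q plane"
  let ?P = "(2, 3) :: real \<times> real"
  have inj: "inj_on (config ?P) {1..4}" unfolding inj_on_config_4 by simp
  have "relabel p ?P = relabel q ?P"
    using map_at_relabel[OF inj_on_config_subset[OF inj]] pq eq by (metis mem_Collect_eq)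
  then show "p = q" using relabel_inj[OF inj] pq by blast
qed

text \<open>By \<open>relabel_comp\<close>, relabelling reverses the order of composition, hence the inverse.\<close>

lemma relabel_iso: "(\<lambda>p. relabel (inv' p) plane) \<in> iso (sym_group 3) group_RS"
proof (rule isoI)
  have inv_image: "inv' ` {p. p permutes {1..3}} = {p. p permutes {1..3::nat}}"
  proof (intro equalityI subsetI)
    fix p :: "nat \<Rightarrow> nat" assume "p \<in> {p. p permutes {1..3}}"
    then show "p \<in> inv' ` {p. p permutes {1..3}}"
      by (intro rev_image_eqI[of "inv' p"])
        (simp_all add: permutes_inv permutes_inv_inv del: One_nat_def)
  qed (auto simp: permutes_inv)
  have image: "(\<lambda>p. relabel (inv' p) plane) ` carrier (sym_group 3) = carrier group_RS"
  proof -
    have "(\<lambda>p. relabel (inv' p) plane) ` carrier (sym_group 3) =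
        (\<lambda>p. relabel p plane) ` (inv' ` {p. p permutes {1..3}})"
      by (simp add: sym_group_def image_image)
    then show ?thesis unfolding inv_image by (simp add: group_RS_def generate_RS)
  qed
  show "(\<lambda>p. relabel (inv' p) plane) \<in> hom (sym_group 3) group_RS"
  proof (rule homI)
    fix p q assume pq: "p \<in> carrier (sym_group 3)" "q \<in> carrier (sym_group 3)"
    then have p: "p permutes {1..3}" and q: "q permutes {1..3}" by (simp_all only: sym_group_carrier)
    have "inv' (p \<circ> q) = inv' q \<circ> inv' p"
      using p q by (meson o_inv_distrib permutes_bij)
    then show "relabel (inv' (p \<otimes>\<^bsub>sym_group 3\<^esub> q)) plane =
        relabel (inv' p) plane \<otimes>\<^bsub>group_RS\<^esub> relabel (inv' q) plane"
      using relabel_comp[OF permutes_inv[OF p] permutes_inv[OF q]]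
      by (simp add: sym_group_mult group_RS_def birational_group_mult)
  qed (use image in blast)
  have "inj_on inv' {p. p permutes {1..3::nat}}"
    using permutes_inv_inv by (metis (mono_tags, lifting) inj_onI mem_Collect_eq)
  then have "inj_on ((\<lambda>p. relabel p plane) \<circ> inv') {p. p permutes {1..3}}"
    using relabel_plane_inj by (intro comp_inj_on) (simp_all only: inv_image)
  then have "inj_on (\<lambda>p. relabel (inv' p) plane) (carrier (sym_group 3))"
    by (simp add: sym_group_def o_def)
  then show "bij_betw (\<lambda>p. relabel (inv' p) plane) (carrier (sym_group 3)) (carrier group_RS)"
    using image by (simp add: bij_betw_def)
qed

theorem theorem2p4:
  shows "group group_RS \<and> group_RS \<cong> sym_group 3 \<and>
    (\<forall>g\<in>carrier group_RS. invariant_under elim_ideal g) \<and>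
    (\<forall>(m::real) (P::real \<times> real). is_position m P \<longrightarrow>
       (\<forall>g\<in>carrier group_RS. map_defined_at g P) \<and>
       inj_on (\<lambda>g. map_at g P) (carrier group_RS) \<and>
       card ((\<lambda>g. map_at g P) ` carrier group_RS) = 6 \<and>
       (\<forall>g\<in>carrier group_RS. is_position m (map_at g P)))"
proof (intro conjI allI impI)
  let ?S = "{p. p permutes {1..3::nat}}"
  have carrier: "carrier group_RS = (\<lambda>p. relabel p plane) ` ?S"
    by (simp add: group_RS_def generate_RS)
  have "{map_R, map_S} \<subseteq> carrier birational_group"
    using relabel_birational perm_R_permutes perm_S_permutes by (simp add: map_R_relabel map_S_relabel)
  then show "group group_RS"
    unfolding group_RS_def
    by (intro group.subgroup_imp_group[OF birational_group] group.generate_is_subgroup[OF birational_group])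
  show "group_RS \<cong> sym_group 3"
    using group.iso_sym[OF sym_group_is_group] relabel_iso by (auto simp: is_iso_def)
  show "\<forall>g\<in>carrier group_RS. invariant_under elim_ideal g"
    by (simp add: carrier relabel_invariant)
  fix m P assume pos: "is_position m P"
  then have inj: "inj_on (config P) {1..4}" by (auto simp: is_position_def is_solution_iff)
  note inj3 = inj_on_config_subset[OF inj]
  have at: "map_at (relabel p plane) P = relabel p P" if "p permutes {1..3}" for p
    by (rule map_at_relabel[OF inj3 that])
  show "\<forall>g\<in>carrier group_RS. map_defined_at g P"
    using map_defined_at_relabel[OF inj3] by (auto simp: carrier)
  show inj_map: "inj_on (\<lambda>g. map_at g P) (carrier group_RS)"
    using relabel_inj[OF inj] by (auto simp: carrier at inj_on_def simp del: One_nat_def)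
  \<comment> \<open>Since evaluation at \<open>P\<close> is injective on the group, the number of
    points is the group order 3! = 6.\<close>
  have "card ?S = fact 3" using card_permutations[of "{1..3::nat}" 3] by simp
  then have "card ?S = 6" by (simp add: fact_numeral)
  then have "card (carrier group_RS) = 6"
    unfolding carrier by (simp add: card_image relabel_plane_inj del: One_nat_def)
  then show "card ((\<lambda>g. map_at g P) ` carrier group_RS) = 6"
    by (simp add: card_image inj_map)
  show "\<forall>g\<in>carrier group_RS. is_position m (map_at g P)"
    using is_position_relabel[OF pos] by (auto simp: carrier at simp del: One_nat_def)
qed

end
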